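(* Let $a,b\in\mathbb N=\{0,1,2,\dots\}$. The space $\mathcal M_{a,b}^1(2)$ of $\mathbb S_2^{(1)}$-valued spherical Hermitian monogenics of bidegree $(a,b)$ in complex dimension $2$ has the following basis: (i) if $a<b$: the polynomials $$p_{a,b;c,0}=\frac1{a!\,b!}\Big(z_1^c\,\overline z_2^{\,b-a+c}Q_{a-c}^{c,b-a+c}\,\mathfrak f_1^\dagger I+z_1^{c+1}\overline z_2^{\,b-a+c+1}Q_{a-c-1}^{c+1,b-a+c+1}\,\mathfrak f_2^\dagger I\Big),\quad c=0,\dots,a,$$ $$\widetilde q_{a,b;0,d}=\frac1{(a+d+1)!\,(b-d)!}\Big((b-d)\,\overline z_1^{\,d+1}\overline z_2^{\,b-d-a-1}Q_a^{d+1,b-d-a-1}\,\mathfrak f_1^\dagger I-(a+d+1)\,\overline z_1^{\,d}\,\overline z_2^{\,b-d-a}Q_a^{d,b-d-a}\,\mathfrak f_2^\dagger I\Big),\quad d=0,\dots,b-a-1,$$ $$q_{a,b;0,d}=\frac1{a!\,b!}\Big(\overline z_1^{\,d+1}z_2^{a-b+d+1}Q_{b-d-1}^{d+1,a-b+d+1}\,\mathfrak f_1^\dagger I-\overline z_1^{\,d}z_2^{a-b+d}Q_{b-d}^{d,a-b+d}\,\mathfrak f_2^\dagger I\Big),\quad d=b-a,\dots,b;$$ (ii) if $a>b$: the polynomials $$\widetilde p_{a,b;c,0}=\frac1{(a-c)!\,(b+c+1)!}\Big((b+c+1)\,z_1^cz_2^{a-c-b}Q_b^{c,a-c-b}\,\mathfrak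 f_1^\dagger I+(a-c)\,z_1^{c+1}z_2^{a-c-b-1}Q_b^{c+1,a-c-b-1}\,\mathfrak f_2^\dagger I\Big),\quad c=0,\dots,a-b-1,$$ $$p_{a,b;c,0}=\frac1{a!\,b!}\Big(z_1^c\,\overline z_2^{\,b-a+c}Q_{a-c}^{c,b-a+c}\,\mathfrak f_1^\dagger I+z_1^{c+1}\overline z_2^{\,b-a+c+1}Q_{a-c-1}^{c+1,b-a+c+1}\,\mathfrak f_2^\dagger I\Big),\quad c=a-b,\dots,a,$$ $$q_{a,b;0,d}=\frac1{a!\,b!}\Big(\overline z_1^{\,d+1}z_2^{a-b+d+1}Q_{b-d-1}^{d+1,a-b+d+1}\,\mathfrak f_1^\dagger I-\overline z_1^{\,d}z_2^{a-b+d}Q_{b-d}^{d,a-b+d}\,\mathfrak f_2^\dagger I\Big),\quad d=0,\dots,b;$$ (iii) if $a=b$: the polynomials $$p_{a,a;c,0}=\frac1{a!\,a!}\Big(z_1^c\,\overline z_2^{\,c}Q_{a-c}^{c,c}\,\mathfrak f_1^\dagger I+z_1^{c+1}\overline z_2^{\,c+1}Q_{a-c-1}^{c+1,c+1}\,\mathfrak f_2^\dagger I\Big),\quad c=0,\dots,a,$$ $$q_{a,a;0,d}=\frac1{a!\,a!}\Big(\overline z_1^{\,d+1}z_2^{d+1}Q_{a-d-1}^{d+1,d+1}\,\mathfrak f_1^\dagger I-\overline z_1^{\,d}z_2^{d}Q_{a-d}^{d,d}\,\mathfrak f_2^\dagger I\Big),\quad d=0,\dots,a.$$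
   Context: **Clifford algebra and spinors ($n=2$).** $\mathbb C_4$ is the complex Clifford algebra generated by $e_1,\dots,e_4$ with $e_\alpha e_\beta+e_\beta e_\alpha=-2\delta_{\alpha\beta}$. The Witt basis $\mathfrak f_j=\frac12(e_j-i\,e_{2+j})$, $\mathfrak f_j^\dagger=-\frac12(e_j+i\,e_{2+j})$, $j=1,2$, satisfies $\mathfrak f_j\mathfrak f_k+\mathfrak f_k\mathfrak f_j=\mathfrak f_j^\dagger\mathfrak f_k^\dagger+\mathfrak f_k^\dagger\mathfrak f_j^\dagger=0$, $\mathfrak f_j\mathfrak f_k^\dagger+\mathfrak f_k^\dagger\mathfrak f_j=\delta_{jk}$. Put $I=\mathfrak f_1\mathfrak f_1^\dagger\mathfrak f_2\mathfrak f_2^\dagger$ (so $\mathfrak f_jI=0$) and $\mathbb S_2^{(1)}=\mathrm{span}_{\mathbb C}\{\mathfrak f_1^\dagger I,\mathfrak f_2^\dagger I\}$. **Hermitian monogenics.** With complex variables $z_1,z_2$ on $\mathbb C^2$, set $\partial_{\underline z}=\mathfrak f_1^\dagger\partial_{z_1}+\mathfrak f_2^\dagger\partial_{z_2}$ and $\partial_{\underline z}^\dagger=\mathfrak f_1\partial_{\overline z_1}+\mathfrak f_2\partial_{\overline z_2}$. $\mathcal M_{a,b}^1(2)$ is the complex vector space of $\mathbb S_2^{(1)}$-valued polynomials $g$ in $z_1,z_2,\overline z_1,\overline z_2$, homogeneous of degree $a$ in $(z_1,z_2)$ and of degree $b$ in $(\overline z_1,\overline z_2)$, with $\partial_{\underline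 z}g=0=\partial_{\underline z}^\dagger g$. **Modified Jacobi polynomials.** For $l\in\mathbb N$, $$Q_l^{\alpha,\beta}=\sum_{s=0}^l\binom{l+\alpha}{s}\binom{l+\beta}{l-s}(-z_1\overline z_1)^{l-s}(z_2\overline z_2)^s,$$ and $Q_{-1}^{\alpha,\beta}=0$. *)

theory Defs
  imports "HOL-Analysis.Analysis" "HOL-Library.Function_Algebras"
begin

section \<open>The complex Clifford algebra on four generators\<close>

text \<open>
  An element is given by its coefficients in the basis of blades
  \<open>e\<^sub>A = e\<^sub>i\<^sub>1 \<cdots> e\<^sub>i\<^sub>k\<close>, where \<open>A = {i\<^sub>1 < \<dots> < i\<^sub>k}\<close> runs through the subsets of \<open>{1..4}\<close>.
\<close>

typedef cliff = "{x :: nat set \<Rightarrow> complex. \<forall>A. \<not> A \<subseteq> {1..4} \<longrightarrow> x A = 0}"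
  morphisms coef Cliff
  by (rule exI[of _ "\<lambda>_. 0"]) simp

setup_lifting type_definition_cliff

text \<open>
  \<open>e\<^sub>A e\<^sub>B = blade_sign A B e\<^sub>C\<close>, where \<open>C\<close> is the symmetric difference of \<open>A\<close> and \<open>B\<close>: sorting the
  product costs one sign for each pair \<open>i > j\<close> and one, from \<open>e\<^sub>i\<^sup>2 = -1\<close>, for each pair \<open>i = j\<close>.
\<close>

definition blade_sign :: "nat set \<Rightarrow> nat set \<Rightarrow> complex" where
  "blade_sign A B = (\<Prod>i\<in>A. \<Prod>j\<in>B. if j \<le> i then -1 else 1)"

lemma prod_sym_diff_sign:
  fixes h :: "nat \<Rightarrow> complex"
  assumes "finite A" "finite B" and h: "\<And>i. h i * h i = 1"
  shows "prod h (sym_diff A B) = prod h A * prod h B"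
proof -
  have 1: "prod h A = prod h (A \<inter> B) * prod h (A - B)"
    using assms by (intro prod.Int_Diff)
  have 2: "prod h B = prod h (A \<inter> B) * prod h (B - A)"
    using assms by (subst Int_commute) (intro prod.Int_Diff)
  have 3: "prod h (A \<inter> B) * prod h (A \<inter> B) = 1"
    by (simp add: prod.distrib[symmetric] h)
  have 4: "prod h (sym_diff A B) = prod h (A - B) * prod h (B - A)"
    using assms by (intro prod.union_disjoint) auto
  show ?thesis using 3 unfolding 1 2 4 by (simp add: mult_ac)
qed

lemma blade_sign_sym_diff_left:
  assumes "finite A" "finite B"
  shows "blade_sign (sym_diff A B) C = blade_sign A C * blade_sign B C"
  unfolding blade_sign_def
  by (intro prod_sym_diff_sign assms)
     (simp only: prod.distrib[symmetric], simp add: prod.neutral)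

lemma blade_sign_sym_diff_right:
  assumes "finite B" "finite C"
  shows "blade_sign A (sym_diff B C) = blade_sign A B * blade_sign A C"
  unfolding blade_sign_def
  by (subst prod_sym_diff_sign) (auto simp: assms prod.distrib)

lemma blade_sign_empty [simp]: "blade_sign {} B = 1" "blade_sign A {} = 1"
  by (simp_all add: blade_sign_def)

lemma sym_diff_cancel: "sym_diff A (sym_diff A B) = B"
  by auto

lemma sym_diff_assoc: "sym_diff (sym_diff A B) C = sym_diff A (sym_diff B C)"
  by auto

lemma sum_reindex_sym_diff:
  fixes f :: "nat set \<Rightarrow> 'a :: comm_monoid_add"
  assumes "A \<subseteq> U"
  shows "(\<Sum>B\<in>Pow U. f B) = (\<Sum>B\<in>Pow U. f (sym_diff A B))"
  by (rule sum.reindex_bij_witness[of _ "sym_diff A" "sym_diff A"])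
     (use assms in \<open>auto simp: sym_diff_cancel\<close>)

lemma cliff_mult_aux:
  fixes x y :: "nat set \<Rightarrow> complex"
  assumes "\<And>A. \<not> A \<subseteq> {1..4} \<Longrightarrow> y A = 0" "\<not> C \<subseteq> {1..4}"
  shows "(\<Sum>A\<in>Pow {1..4}. blade_sign A (sym_diff A C) * x A * y (sym_diff A C)) = 0"
proof (intro sum.neutral ballI)
  fix A :: "nat set"
  assume "A \<in> Pow {1..4}"
  with assms(2) have "\<not> sym_diff A C \<subseteq> {1..4}" by blast
  with assms(1) show "blade_sign A (sym_diff A C) * x A * y (sym_diff A C) = 0" by simp
qed

lemma cliff_mult_assoc_aux:
  fixes x y z :: "nat set \<Rightarrow> complex"
  assumes D: "D \<subseteq> {1..4}"
  shows "(\<Sum>C\<in>Pow {1..4}. blade_sign C (sym_diff C D) *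
             (\<Sum>A\<in>Pow {1..4}. blade_sign A (sym_diff A C) * x A * y (sym_diff A C)) * z (sym_diff C D)) =
         (\<Sum>A\<in>Pow {1..4}. blade_sign A (sym_diff A D) * x A *
             (\<Sum>B\<in>Pow {1..4}. blade_sign B (sym_diff B (sym_diff A D)) * y B * z (sym_diff B (sym_diff A D))))"
    (is "?L = ?R")
proof -
  let ?U = "{1..4} :: nat set"
  have "?L = (\<Sum>A\<in>Pow ?U. \<Sum>C\<in>Pow ?U. blade_sign C (sym_diff C D) * blade_sign A (sym_diff A C)
                 * x A * y (sym_diff A C) * z (sym_diff C D))"
    by (subst sum.swap) (simp add: sum_distrib_left sum_distrib_right mult_ac)
  also have "\<dots> = (\<Sum>A\<in>Pow ?U. \<Sum>B\<in>Pow ?U. blade_sign (sym_diff A B) (sym_diff (sym_diff A B) D)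
                 * blade_sign A (sym_diff A (sym_diff A B))
                 * x A * y (sym_diff A (sym_diff A B)) * z (sym_diff (sym_diff A B) D))"
    by (intro sum.cong refl sum_reindex_sym_diff) auto
  also have "\<dots> = (\<Sum>A\<in>Pow ?U. \<Sum>B\<in>Pow ?U. blade_sign A (sym_diff A D) * x A *
                (blade_sign B (sym_diff B (sym_diff A D)) * y B * z (sym_diff B (sym_diff A D))))"
  proof (intro sum.cong refl)
    fix A B assume "A \<in> Pow ?U" "B \<in> Pow ?U"
    then have fin: "finite A" "finite B" "finite D"
      using D by (auto intro: finite_subset)
    define E where "E = sym_diff (sym_diff A B) D"
    have E': "sym_diff B (sym_diff A D) = E" and AD: "sym_diff A D = sym_diff B E"
      unfolding E_def by auto
    have "finite E" using fin by (auto simp: E_def)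
    then have "blade_sign (sym_diff A B) E * blade_sign A B = blade_sign A (sym_diff A D) * blade_sign B E"
      unfolding AD using fin by (simp add: blade_sign_sym_diff_left blade_sign_sym_diff_right)
    then show "blade_sign (sym_diff A B) (sym_diff (sym_diff A B) D)
                 * blade_sign A (sym_diff A (sym_diff A B))
                 * x A * y (sym_diff A (sym_diff A B)) * z (sym_diff (sym_diff A B) D) =
               blade_sign A (sym_diff A D) * x A *
                (blade_sign B (sym_diff B (sym_diff A D)) * y B * z (sym_diff B (sym_diff A D)))"
      unfolding sym_diff_cancel E' unfolding E_def[symmetric] by (simp add: mult_ac)
  qed
  also have "\<dots> = ?R"
    by (simp add: sum_distrib_left)
  finally show ?thesis .
qed

instantiation cliff :: ring_1
begin

lift_definition zero_cliff :: cliff is "\<lambda>_. 0" by simp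
lift_definition one_cliff :: cliff is "\<lambda>A. if A = {} then 1 else 0" by auto
lift_definition plus_cliff :: "cliff \<Rightarrow> cliff \<Rightarrow> cliff" is "\<lambda>x y A. x A + y A" by simp
lift_definition minus_cliff :: "cliff \<Rightarrow> cliff \<Rightarrow> cliff" is "\<lambda>x y A. x A - y A" by simp
lift_definition uminus_cliff :: "cliff \<Rightarrow> cliff" is "\<lambda>x A. - x A" by simp
lift_definition times_cliff :: "cliff \<Rightarrow> cliff \<Rightarrow> cliff" is
  "\<lambda>x y C. \<Sum>A\<in>Pow {1..4}. blade_sign A (sym_diff A C) * x A * y (sym_diff A C)"
  by (rule cliff_mult_aux)

instance
proof
  fix a b c :: cliff
  have coef_0: "coef x A = 0" if "\<not> A \<subseteq> {1..4}" for x A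
    using coef[of x] that by auto
  show "a * b * c = a * (b * c)"
  proof (rule coef_inject[THEN iffD1], rule ext)
    fix D :: "nat set"
    show "coef (a * b * c) D = coef (a * (b * c)) D"
    proof (cases "D \<subseteq> {1..4}")
      case True
      then show ?thesis
        unfolding times_cliff.rep_eq by (rule cliff_mult_assoc_aux)
    qed (simp add: coef_0)
  qed
  show "1 * a = a"
  proof (rule coef_inject[THEN iffD1], rule ext)
    fix C :: "nat set"
    have "coef (1 * a) C = (\<Sum>A\<in>Pow {1..4::nat}. if A = {} then coef a C else 0)"
      unfolding times_cliff.rep_eq one_cliff.rep_eq by (intro sum.cong) auto
    then show "coef (1 * a) C = coef a C"
      by simp
  qed
  show "a * 1 = a"
  proof (rule coef_inject[THEN iffD1], rule ext)
    fix C :: "nat set"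
    have [simp]: "sym_diff A C = {} \<longleftrightarrow> A = C" for A by auto
    have "coef (a * 1) C = (\<Sum>A\<in>Pow {1..4::nat}. if A = C then coef a C else 0)"
      unfolding times_cliff.rep_eq one_cliff.rep_eq by (intro sum.cong) auto
    also have "\<dots> = coef a C"
      using coef_0[of C a] by simp
    finally show "coef (a * 1) C = coef a C" .
  qed
  show "(a + b) * c = a * c + b * c" "a * (b + c) = a * b + a * c"
    by (transfer; simp add: ring_distribs sum.distrib)+
  show "a + b + c = a + (b + c)" "a + b = b + a" "0 + a = a" "- a + a = 0" "a - b = a + - b"
    by (transfer; simp add: add_ac)+
  show "(0 :: cliff) \<noteq> 1"
    by transfer (auto simp: fun_eq_iff)
qed

end

lift_definition cliff_scale :: "complex \<Rightarrow> cliff \<Rightarrow> cliff" (infixr "*\<^sub>c" 75) is "\<lambda>c x A. c * x A"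
  by simp

global_interpretation cliff: vector_space cliff_scale
proof
  fix a b :: complex and x y :: cliff
  show "a *\<^sub>c (x + y) = a *\<^sub>c x + a *\<^sub>c y" by transfer (simp add: distrib_left)
  show "(a + b) *\<^sub>c x = a *\<^sub>c x + b *\<^sub>c x" by transfer (simp add: distrib_right)
  show "a *\<^sub>c b *\<^sub>c x = (a * b) *\<^sub>c x" by transfer (simp add: mult.assoc)
  show "1 *\<^sub>c x = x" by transfer simp
qed

lemma cliff_scale_mult:
  "(c *\<^sub>c x) * y = c *\<^sub>c (x * y)" "x * (c *\<^sub>c y) = c *\<^sub>c (x * y)"
  by (transfer; simp add: sum_distrib_left mult_ac)+

lift_definition blade :: "nat set \<Rightarrow> cliff" is "\<lambda>A B. if B = A \<and> A \<subseteq> {1..4} then 1 else 0"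
  by auto

definition gen :: "nat \<Rightarrow> cliff" where
  "gen \<alpha> = blade {\<alpha>}"

lemma blade_mult:
  assumes "A \<subseteq> {1..4}" "B \<subseteq> {1..4}"
  shows "blade A * blade B = blade_sign A B *\<^sub>c blade (sym_diff A B)"
proof (rule coef_inject[THEN iffD1], rule ext)
  fix C :: "nat set"
  have AB: "sym_diff A B \<subseteq> {1..4}" using assms by blast
  have iff: "sym_diff A C = B \<longleftrightarrow> C = sym_diff A B" by blast
  have "coef (blade A * blade B) C =
        (\<Sum>D\<in>Pow {1..4}. if D = A then if sym_diff A C = B then blade_sign A B else 0 else 0)"
    unfolding times_cliff.rep_eq blade.rep_eq using assms by (intro sum.cong) (simp_all del: Un_subset_iff)
  also have "\<dots> = (if sym_diff A C = B then blade_sign A B else 0)"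
    using assms(1) by simp
  also have "\<dots> = coef (blade_sign A B *\<^sub>c blade (sym_diff A B)) C"
    unfolding cliff_scale.rep_eq blade.rep_eq iff using AB by simp
  finally show "coef (blade A * blade B) C = coef (blade_sign A B *\<^sub>c blade (sym_diff A B)) C" .
qed

lemma blade_empty: "blade {} = 1"
  by transfer auto

text \<open>The defining relations, and the blades as ordered products of the generators:\<close>

lemma gen_anticommute:
  assumes "\<alpha> \<in> {1..4}" "\<beta> \<in> {1..4}"
  shows "gen \<alpha> * gen \<beta> + gen \<beta> * gen \<alpha> = (if \<alpha> = \<beta> then - 2 else 0)"
proof -
  have [simp]: "(- 1) *\<^sub>c x = - x" "1 *\<^sub>c x = x" for x by (transfer; simp)+
  have "gen \<alpha> * gen \<beta> + gen \<beta> * gen \<alpha> =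
      (if \<beta> \<le> \<alpha> then -1 else 1) *\<^sub>c blade (sym_diff {\<alpha>} {\<beta>}) +
      (if \<alpha> \<le> \<beta> then -1 else 1) *\<^sub>c blade (sym_diff {\<beta>} {\<alpha>})"
    unfolding gen_def using assms by (subst (1 2) blade_mult) (simp_all add: blade_sign_def)
  also have "sym_diff {\<beta>} {\<alpha>} = sym_diff {\<alpha>} {\<beta>}" by auto
  finally show ?thesis
    by (cases "\<alpha> = \<beta>"; cases "\<alpha> < \<beta>") (simp_all add: blade_empty)
qed

lemma blade_Cons:
  assumes "A \<subseteq> {1..4}" "k \<in> {1..4}" "\<And>i. i \<in> A \<Longrightarrow> k < i"
  shows "blade (insert k A) = gen k * blade A"
proof -
  have "blade_sign {k} A = 1"
    unfolding blade_sign_def using assms(3) by (auto intro!: prod.neutral simp flip: not_less)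
  moreover have "sym_diff {k} A = insert k A" using assms(3) by auto
  ultimately show ?thesis
    using assms unfolding gen_def by (simp add: blade_mult)
qed

lemma blade_conv_prod_list:
  assumes "sorted_wrt (<) ks" "set ks \<subseteq> {1..4}"
  shows "blade (set ks) = prod_list (map gen ks)"
  using assms by (induction ks) (simp_all add: blade_empty blade_Cons)

lemma cliff_expand: "x = (\<Sum>A\<in>Pow {1..4}. coef x A *\<^sub>c blade A)"
proof (rule coef_inject[THEN iffD1], rule ext)
  fix B
  have coef_sum: "coef (\<Sum>A\<in>S. f A) B = (\<Sum>A\<in>S. coef (f A) B)" if "finite S" for S and f :: "nat set \<Rightarrow> cliff"
    using that by induction (simp_all add: zero_cliff.rep_eq plus_cliff.rep_eq)
  have "coef (\<Sum>A\<in>Pow {1..4}. coef x A *\<^sub>c blade A) B =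
      (\<Sum>A\<in>Pow {1..4}. coef (coef x A *\<^sub>c blade A) B)"
    by (rule coef_sum) simp
  also have "\<dots> = (\<Sum>A\<in>Pow {1..4}. if B = A then coef x B else 0)"
    by (intro sum.cong refl) (simp add: cliff_scale.rep_eq blade.rep_eq)
  also have "\<dots> = coef x B"
    using coef[of x] by (cases "B \<subseteq> {1..4}") simp_all
  finally show "coef x B = coef (\<Sum>A\<in>Pow {1..4}. coef x A *\<^sub>c blade A) B" ..
qed

subsection \<open>Witt basis and spinors\<close>

definition witt :: "nat \<Rightarrow> cliff" where
  "witt j = (1/2) *\<^sub>c (gen j - \<i> *\<^sub>c gen (2 + j))"

definition witt_dag :: "nat \<Rightarrow> cliff" where
  "witt_dag j = (- 1/2) *\<^sub>c (gen j + \<i> *\<^sub>c gen (2 + j))"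

definition spinor_I :: cliff where
  "spinor_I = witt 1 * witt_dag 1 * witt 2 * witt_dag 2"

abbreviation f1I :: cliff where "f1I \<equiv> witt_dag 1 * spinor_I"
abbreviation f2I :: cliff where "f2I \<equiv> witt_dag 2 * spinor_I"

definition spinor_space1 :: "cliff set" where
  "spinor_space1 = cliff.span {f1I, f2I}"

section \<open>Clifford-valued functions on \<open>\<complex>\<^sup>2\<close>\<close>

type_synonym cfun = "complex \<times> complex \<Rightarrow> cliff"

definition cfun_scale :: "complex \<Rightarrow> cfun \<Rightarrow> cfun" where
  "cfun_scale c g = (\<lambda>z. c *\<^sub>c g z)"

global_interpretation cfun: vector_space cfun_scale
  by unfold_locales
     (simp_all add: cfun_scale_def fun_eq_iff cliff.scale_right_distrib cliff.scale_left_distrib)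

definition dir_deriv :: "complex \<times> complex \<Rightarrow> (complex \<times> complex \<Rightarrow> complex) \<Rightarrow> complex \<times> complex \<Rightarrow> complex" where
  "dir_deriv v h z = vector_derivative (\<lambda>t::real. h (z + t *\<^sub>R v)) (at 0)"

text \<open>Scalar operators act on the coefficients of a Clifford-valued function.\<close>

definition lift_op ::
  "((complex \<times> complex \<Rightarrow> complex) \<Rightarrow> complex \<times> complex \<Rightarrow> complex) \<Rightarrow> cfun \<Rightarrow> cfun" where
  "lift_op T g z = (\<Sum>A\<in>Pow {1..4}. T (\<lambda>w. coef (g w) A) z *\<^sub>c blade A)"

text \<open>
  Wirtinger derivatives: for \<open>z\<^sub>j = x\<^sub>j + \<i> y\<^sub>j\<close>, the directions \<open>(1, 0)\<close>, \<open>(\<i>, 0)\<close>, \<open>(0, 1)\<close>, \<open>(0, \<i>)\<close>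
  belong to the real coordinates \<open>x\<^sub>1\<close>, \<open>y\<^sub>1\<close>, \<open>x\<^sub>2\<close>, \<open>y\<^sub>2\<close>.
\<close>

definition d_z1 :: "cfun \<Rightarrow> cfun" where
  "d_z1 = lift_op (\<lambda>h z. (dir_deriv (1, 0) h z - \<i> * dir_deriv (\<i>, 0) h z) / 2)"

definition d_z2 :: "cfun \<Rightarrow> cfun" where
  "d_z2 = lift_op (\<lambda>h z. (dir_deriv (0, 1) h z - \<i> * dir_deriv (0, \<i>) h z) / 2)"

definition d_z1bar :: "cfun \<Rightarrow> cfun" where
  "d_z1bar = lift_op (\<lambda>h z. (dir_deriv (1, 0) h z + \<i> * dir_deriv (\<i>, 0) h z) / 2)"

definition d_z2bar :: "cfun \<Rightarrow> cfun" where
  "d_z2bar = lift_op (\<lambda>h z. (dir_deriv (0, 1) h z + \<i> * dir_deriv (0, \<i>) h z) / 2)"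

definition dirac_z :: "cfun \<Rightarrow> cfun" where
  "dirac_z g z = witt_dag 1 * d_z1 g z + witt_dag 2 * d_z2 g z"

definition dirac_z_dag :: "cfun \<Rightarrow> cfun" where
  "dirac_z_dag g z = witt 1 * d_z1bar g z + witt 2 * d_z2bar g z"

definition bihomogeneous_poly :: "nat \<Rightarrow> nat \<Rightarrow> cfun \<Rightarrow> bool" where
  "bihomogeneous_poly a b g \<longleftrightarrow>
     (\<exists>c :: nat \<Rightarrow> nat \<Rightarrow> cliff. \<forall>z1 z2. g (z1, z2) =
        (\<Sum>i\<le>a. \<Sum>k\<le>b. (z1 ^ i * z2 ^ (a - i) * cnj z1 ^ k * cnj z2 ^ (b - k)) *\<^sub>c c i k))"

definition hmonogenic1 :: "nat \<Rightarrow> nat \<Rightarrow> cfun set" where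
  "hmonogenic1 a b =
     {g. bihomogeneous_poly a b g \<and> range g \<subseteq> spinor_space1 \<and> dirac_z g = 0 \<and> dirac_z_dag g = 0}"

text \<open>The entries of the list are pairwise distinct, so this is a basis in the sense of families.\<close>

definition is_basis :: "cfun list \<Rightarrow> cfun set \<Rightarrow> bool" where
  "is_basis gs V \<longleftrightarrow> distinct gs \<and> \<not> cfun.dependent (set gs) \<and> cfun.span (set gs) = V"

section \<open>The polynomials\<close>

text \<open>
  Indices are integers, so that exponents such as \<open>b - a + c\<close> and the index \<open>l = -1\<close> can be written
  without truncated subtraction.
\<close>

definition jacobiQ :: "int \<Rightarrow> int \<Rightarrow> int \<Rightarrow> complex \<times> complex \<Rightarrow> complex" where
  "jacobiQ l \<alpha> \<beta> = (\<lambda>(z1, z2).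
     if l < 0 then 0
     else (\<Sum>s\<le>nat l. (of_int (l + \<alpha>) gchoose s) * (of_int (l + \<beta>) gchoose (nat l - s)) *
             (- z1 * cnj z1) ^ (nat l - s) * (z2 * cnj z2) ^ s))"

definition p_poly :: "int \<Rightarrow> int \<Rightarrow> int \<Rightarrow> cfun" where
  "p_poly a b c = (\<lambda>(z1, z2). (1 / (fact (nat a) * fact (nat b))) *\<^sub>c
     ((z1 powi c * cnj z2 powi (b - a + c) * jacobiQ (a - c) c (b - a + c) (z1, z2)) *\<^sub>c f1I
    + (z1 powi (c + 1) * cnj z2 powi (b - a + c + 1)
         * jacobiQ (a - c - 1) (c + 1) (b - a + c + 1) (z1, z2)) *\<^sub>c f2I))"

definition p_tilde :: "int \<Rightarrow> int \<Rightarrow> int \<Rightarrow> cfun" where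
  "p_tilde a b c = (\<lambda>(z1, z2). (1 / (fact (nat (a - c)) * fact (nat (b + c + 1)))) *\<^sub>c
     ((of_int (b + c + 1) * z1 powi c * z2 powi (a - c - b) * jacobiQ b c (a - c - b) (z1, z2)) *\<^sub>c f1I
    + (of_int (a - c) * z1 powi (c + 1) * z2 powi (a - c - b - 1)
         * jacobiQ b (c + 1) (a - c - b - 1) (z1, z2)) *\<^sub>c f2I))"

definition q_poly :: "int \<Rightarrow> int \<Rightarrow> int \<Rightarrow> cfun" where
  "q_poly a b d = (\<lambda>(z1, z2). (1 / (fact (nat a) * fact (nat b))) *\<^sub>c
     ((cnj z1 powi (d + 1) * z2 powi (a - b + d + 1)
         * jacobiQ (b - d - 1) (d + 1) (a - b + d + 1) (z1, z2)) *\<^sub>c f1I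
    - (cnj z1 powi d * z2 powi (a - b + d) * jacobiQ (b - d) d (a - b + d) (z1, z2)) *\<^sub>c f2I))"

definition q_tilde :: "int \<Rightarrow> int \<Rightarrow> int \<Rightarrow> cfun" where
  "q_tilde a b d = (\<lambda>(z1, z2). (1 / (fact (nat (a + d + 1)) * fact (nat (b - d)))) *\<^sub>c
     ((of_int (b - d) * cnj z1 powi (d + 1) * cnj z2 powi (b - d - a - 1)
         * jacobiQ a (d + 1) (b - d - a - 1) (z1, z2)) *\<^sub>c f1I
    - (of_int (a + d + 1) * cnj z1 powi d * cnj z2 powi (b - d - a)
         * jacobiQ a d (b - d - a) (z1, z2)) *\<^sub>c f2I))"

end

theory Submission
  imports Defs
begin

text \<open>
  Write \<open>g = F f1I + G f2I\<close> and let \<open>F\<^sub>i\<^sub>,\<^sub>k\<close>, \<open>G\<^sub>i\<^sub>,\<^sub>k\<close> be the coefficients at the monomial of degree \<open>i\<close> in \<open>z\<^sub>1\<close> and \<open>k\<close>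
  in its conjugate. The Witt relations reduce the two differential equations to one scalar equation each,
  and on coefficients these read \<open>(i + 1) G\<^sub>i\<^sub>+\<^sub>1\<^sub>,\<^sub>k = (a - i) F\<^sub>i\<^sub>,\<^sub>k\<close> and \<open>(k + 1) F\<^sub>i\<^sub>,\<^sub>k\<^sub>+\<^sub>1 = - (b - k) G\<^sub>i\<^sub>,\<^sub>k\<close>
  (\<open>spinor_poly_hmonogenic1_iff\<close>).

  Both recursions are solved by \<open>F\<^sub>i\<^sub>,\<^sub>k = G\<^sub>i\<^sub>,\<^sub>k = (- 1) ^ k C(a, i) C(b, k)\<close>, and they respect the weight \<open>m\<close> that is
  \<open>i - k\<close> on \<open>F\<close> and \<open>i - k - 1\<close> on \<open>G\<close>. Within one weight they link all coefficients into one chain, with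
  nonzero factors, so the solution is unique up to a scalar (\<open>hmonogenic1_eq_range_weight_series\<close>). The
  weights run from \<open>- b - 1\<close> to \<open>a\<close>, and one nonzero vector in each of them is a basis
  (\<open>is_basis_weight_vectors\<close>).

  It remains to see that the given polynomials are such vectors, each weight being hit once: the families
  \<open>p\<close> with index \<open>c\<close> have weight \<open>c\<close>, and the families \<open>q\<close> with index \<open>d\<close> have weight \<open>- d - 1\<close>. The \<open>Q\<close>
  polynomials are, up to a constant, the sums of \<open>(- 1) ^ k C(a, i) C(b, k)\<close> times the monomials over a
  diagonal \<open>i - k = m\<close> of the rectangle of exponents, with the common monomial factor removed. Whether the
  family with or without tilde applies depends on the side through which the diagonal leaves that
  rectangle (\<open>diagonal_eq_jacobiQ_short\<close>, \<open>diagonal_eq_jacobiQ_long\<close>).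
\<close>

(* The index 1 of a Witt vector and the lower end of the range of generators stay literal in rewriting. *)
declare One_nat_def [simp del]

section \<open>Wirtinger derivatives\<close>

text \<open>
  The real derivative of \<open>h\<close> at \<open>z\<close> in the coordinates \<open>dz\<^sub>1\<close>, \<open>dz\<^sub>2\<close> and their conjugates: \<open>p1\<close>, \<open>p2\<close> are the
  values of \<open>\<partial>h/\<partial>z\<^sub>1\<close>, \<open>\<partial>h/\<partial>z\<^sub>2\<close> and \<open>q1\<close>, \<open>q2\<close> those of the derivatives by the conjugate variables. Bundling the
  four makes the chain and product rules of the full derivative available.
\<close>

definition wirtinger_at ::
  "(complex \<times> complex \<Rightarrow> complex) \<Rightarrow> complex \<Rightarrow> complex \<Rightarrow> complex \<Rightarrow> complex \<Rightarrow> complex \<times> complex \<Rightarrow> bool" where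
  "wirtinger_at h p1 p2 q1 q2 z \<longleftrightarrow>
     (h has_derivative (\<lambda>v. fst v * p1 + snd v * p2 + cnj (fst v) * q1 + cnj (snd v) * q2)) (at z)"

lemma dir_deriv_eq:
  assumes "(h has_derivative D) (at z)"
  shows "dir_deriv v h z = D v"
proof -
  have "((\<lambda>t::real. z + t *\<^sub>R v) has_derivative (\<lambda>t. t *\<^sub>R v)) (at 0)"
    by (auto intro!: derivative_eq_intros)
  then have "((\<lambda>t::real. h (z + t *\<^sub>R v)) has_derivative (\<lambda>t. D (t *\<^sub>R v))) (at 0)"
    by (rule has_derivative_compose) (use assms in simp)
  then have "((\<lambda>t::real. h (z + t *\<^sub>R v)) has_vector_derivative D v) (at 0)"
    using has_derivative_bounded_linear[OF assms]
    by (simp add: has_vector_derivative_def linear_cmul bounded_linear.linear)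
  then show ?thesis
    unfolding dir_deriv_def by (rule vector_derivative_at)
qed

lemma wirtinger_at_linear_combination:
  assumes "wirtinger_at F p1 p2 q1 q2 z" "wirtinger_at G p1' p2' q1' q2' z"
  shows "wirtinger_at (\<lambda>w. F w * x + G w * y)
           (p1 * x + p1' * y) (p2 * x + p2' * y) (q1 * x + q1' * y) (q2 * x + q2' * y) z"
  using assms unfolding wirtinger_at_def
  by (auto intro!: derivative_eq_intros simp: algebra_simps)

lemma wirtinger_at_sum:
  assumes "\<And>i. i \<in> S \<Longrightarrow> wirtinger_at (h i) (p1 i) (p2 i) (q1 i) (q2 i) z"
  shows "wirtinger_at (\<lambda>w. \<Sum>i\<in>S. h i w) (sum p1 S) (sum p2 S) (sum q1 S) (sum q2 S) z"
  using assms unfolding wirtinger_at_def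
  by (auto intro!: derivative_eq_intros simp: sum.distrib sum_distrib_left)

lemma wirtinger_at_monomial:
  "wirtinger_at (\<lambda>w. c * (fst w ^ i * snd w ^ j * cnj (fst w) ^ k * cnj (snd w) ^ l))
     (c * (of_nat i * x ^ (i - 1) * y ^ j * cnj x ^ k * cnj y ^ l))
     (c * (x ^ i * (of_nat j * y ^ (j - 1)) * cnj x ^ k * cnj y ^ l))
     (c * (x ^ i * y ^ j * (of_nat k * cnj x ^ (k - 1)) * cnj y ^ l))
     (c * (x ^ i * y ^ j * cnj x ^ k * (of_nat l * cnj y ^ (l - 1)))) (x, y)"
  unfolding wirtinger_at_def
  by (auto intro!: derivative_eq_intros simp: algebra_simps)

text \<open>
  An operator that is linear on the span of \<open>F\<close> and \<open>G\<close> can be applied to the two scalar factors instead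
  of blade by blade, because the blade coefficients of \<open>F u + G v\<close> are themselves combinations of \<open>F\<close> and \<open>G\<close>.
\<close>

lemma lift_op_spinor:
  assumes "\<And>x y. T (\<lambda>w. F w * x + G w * y) z = P * x + Q * y"
  shows "lift_op T (\<lambda>w. F w *\<^sub>c u + G w *\<^sub>c v) z = P *\<^sub>c u + Q *\<^sub>c v"
proof -
  have "lift_op T (\<lambda>w. F w *\<^sub>c u + G w *\<^sub>c v) z =
      (\<Sum>A\<in>Pow {1..4}. coef (P *\<^sub>c u + Q *\<^sub>c v) A *\<^sub>c blade A)"
    unfolding lift_op_def by (simp add: plus_cliff.rep_eq cliff_scale.rep_eq assms)
  then show ?thesis
    by (simp flip: cliff_expand)
qed

lemma wirtinger_at_dir_deriv:
  assumes "wirtinger_at h p1 p2 q1 q2 z"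
  shows "(dir_deriv (1, 0) h z - \<i> * dir_deriv (\<i>, 0) h z) / 2 = p1"
    and "(dir_deriv (0, 1) h z - \<i> * dir_deriv (0, \<i>) h z) / 2 = p2"
    and "(dir_deriv (1, 0) h z + \<i> * dir_deriv (\<i>, 0) h z) / 2 = q1"
    and "(dir_deriv (0, 1) h z + \<i> * dir_deriv (0, \<i>) h z) / 2 = q2"
  unfolding dir_deriv_eq[OF assms[unfolded wirtinger_at_def]]
  by (simp_all add: right_diff_distrib distrib_left flip: mult.assoc)

lemma wirtinger_lift:
  assumes "wirtinger_at F p1 p2 q1 q2 z" "wirtinger_at G p1' p2' q1' q2' z"
  shows "d_z1 (\<lambda>w. F w *\<^sub>c u + G w *\<^sub>c v) z = p1 *\<^sub>c u + p1' *\<^sub>c v"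
    and "d_z2 (\<lambda>w. F w *\<^sub>c u + G w *\<^sub>c v) z = p2 *\<^sub>c u + p2' *\<^sub>c v"
    and "d_z1bar (\<lambda>w. F w *\<^sub>c u + G w *\<^sub>c v) z = q1 *\<^sub>c u + q1' *\<^sub>c v"
    and "d_z2bar (\<lambda>w. F w *\<^sub>c u + G w *\<^sub>c v) z = q2 *\<^sub>c u + q2' *\<^sub>c v"
  unfolding d_z1_def d_z2_def d_z1bar_def d_z2bar_def
  by (rule lift_op_spinor,
      rule wirtinger_at_dir_deriv[OF wirtinger_at_linear_combination[OF assms]])+

section \<open>Bihomogeneous polynomials\<close>

definition bipoly :: "nat \<Rightarrow> nat \<Rightarrow> (nat \<Rightarrow> nat \<Rightarrow> complex) \<Rightarrow> complex \<times> complex \<Rightarrow> complex" where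
  "bipoly a b c z =
     (\<Sum>i\<le>a. \<Sum>k\<le>b. c i k * (fst z ^ i * snd z ^ (a - i) * cnj (fst z) ^ k * cnj (snd z) ^ (b - k)))"

lemma sum_derivative_left:
  fixes c :: "nat \<Rightarrow> complex"
  shows "(\<Sum>i\<le>n. c i * (of_nat i * x ^ (i - 1) * y ^ (n - i))) =
    (\<Sum>i\<le>n - 1. of_bool (i < n) * of_nat (Suc i) * c (Suc i) * (x ^ i * y ^ (n - 1 - i)))"
  by (cases n) (simp_all add: sum.atMost_Suc_shift mult_ac del: sum.atMost_Suc of_nat_Suc)

lemma sum_derivative_right:
  fixes c :: "nat \<Rightarrow> complex"
  shows "(\<Sum>i\<le>n. c i * (x ^ i * (of_nat (n - i) * y ^ (n - i - 1)))) =
    (\<Sum>i\<le>n - 1. of_nat (n - i) * c i * (x ^ i * y ^ (n - 1 - i)))"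
  by (cases n) (simp_all add: mult_ac of_nat_diff)

text \<open>
  Differentiation shifts coefficients. The factor \<open>of_bool\<close> removes the coefficient with index \<open>Suc a\<close>, which
  lies outside the polynomial but would otherwise enter for \<open>a = 0\<close>, where the truncated degree \<open>a - 1\<close>
  is \<open>0\<close> again.
\<close>

lemma wirtinger_at_bipoly:
  "wirtinger_at (bipoly a b c)
     (bipoly (a - 1) b (\<lambda>i k. of_bool (i < a) * of_nat (Suc i) * c (Suc i) k) z)
     (bipoly (a - 1) b (\<lambda>i k. of_nat (a - i) * c i k) z)
     (bipoly a (b - 1) (\<lambda>i k. of_bool (k < b) * of_nat (Suc k) * c i (Suc k)) z)
     (bipoly a (b - 1) (\<lambda>i k. of_nat (b - k) * c i k) z) z"
proof -
  obtain x y where z: "z = (x, y)" by (cases z)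
  have 1: "bipoly (a - 1) b (\<lambda>i k. of_bool (i < a) * of_nat (Suc i) * c (Suc i) k) z =
      (\<Sum>i\<le>a. \<Sum>k\<le>b. c i k * (of_nat i * x ^ (i - 1) * y ^ (a - i) * cnj x ^ k * cnj y ^ (b - k)))"
    unfolding bipoly_def z
    using sum_derivative_left[of "\<lambda>i. c i k * (cnj x ^ k * cnj y ^ (b - k))" x y a for k]
    by (intro trans[OF sum.swap trans[OF sum.cong sum.swap]] refl)
      (simp add: mult_ac del: of_nat_Suc)
  have 2: "bipoly (a - 1) b (\<lambda>i k. of_nat (a - i) * c i k) z =
      (\<Sum>i\<le>a. \<Sum>k\<le>b. c i k * (x ^ i * (of_nat (a - i) * y ^ (a - i - 1)) * cnj x ^ k * cnj y ^ (b - k)))"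
    unfolding bipoly_def z
    using sum_derivative_right[of "\<lambda>i. c i k * (cnj x ^ k * cnj y ^ (b - k))" x a y for k]
    by (intro trans[OF sum.swap trans[OF sum.cong sum.swap]] refl) (simp add: mult_ac)
  have 3: "bipoly a (b - 1) (\<lambda>i k. of_bool (k < b) * of_nat (Suc k) * c i (Suc k)) z =
      (\<Sum>i\<le>a. \<Sum>k\<le>b. c i k * (x ^ i * y ^ (a - i) * (of_nat k * cnj x ^ (k - 1)) * cnj y ^ (b - k)))"
    unfolding bipoly_def z
    by (rule sum.cong[OF refl])
      (use sum_derivative_left[of "\<lambda>k. c i k * (x ^ i * y ^ (a - i))" "cnj x" "cnj y" b for i]
        in \<open>simp add: mult_ac del: of_nat_Suc\<close>)
  have 4: "bipoly a (b - 1) (\<lambda>i k. of_nat (b - k) * c i k) z =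
      (\<Sum>i\<le>a. \<Sum>k\<le>b. c i k * (x ^ i * y ^ (a - i) * cnj x ^ k * (of_nat (b - k) * cnj y ^ (b - k - 1))))"
    unfolding bipoly_def z
    by (rule sum.cong[OF refl])
      (use sum_derivative_right[of "\<lambda>k. c i k * (x ^ i * y ^ (a - i))" "cnj x" b "cnj y" for i]
        in \<open>simp add: mult_ac\<close>)
  show ?thesis
    unfolding 1 2 3 4 unfolding bipoly_def[abs_def] z
    by (intro wirtinger_at_sum wirtinger_at_monomial)
qed

lemma wirtinger_at_unique:
  assumes "wirtinger_at h p1 p2 q1 q2 z" "wirtinger_at h p1' p2' q1' q2' z"
  shows "p1 = p1'" "p2 = p2'" "q1 = q1'" "q2 = q2'"
proof -
  have "(\<lambda>v. fst v * p1 + snd v * p2 + cnj (fst v) * q1 + cnj (snd v) * q2) =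
        (\<lambda>v. fst v * p1' + snd v * p2' + cnj (fst v) * q1' + cnj (snd v) * q2')"
    using assms unfolding wirtinger_at_def by (rule has_derivative_unique)
  then have eq: "fst v * p1 + snd v * p2 + cnj (fst v) * q1 + cnj (snd v) * q2 =
        fst v * p1' + snd v * p2' + cnj (fst v) * q1' + cnj (snd v) * q2'" for v
    by meson
  have a: "p1 + q1 = p1' + q1'" "p2 + q2 = p2' + q2'"
    using eq[of "(1, 0)"] eq[of "(0, 1)"] by simp_all
  have b: "p1 - q1 = p1' - q1'" "p2 - q2 = p2' - q2'"
    using arg_cong[OF eq[of "(\<i>, 0)"], of "\<lambda>u. - \<i> * u"]
      arg_cong[OF eq[of "(0, \<i>)"], of "\<lambda>u. - \<i> * u"] by (simp_all add: algebra_simps)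
  show "p1 = p1'" "q1 = q1'" "p2 = p2'" "q2 = q2'"
    using a b by (simp_all add: complex_eq_iff)
qed

text \<open>
  Polynomials in \<open>z\<close> and its conjugate have unique coefficients. A vanishing polynomial has vanishing
  derivatives, of lower degree; up to nonzero factors the coefficients of \<open>\<partial>/\<partial>z\<^sub>2\<close> are those with \<open>i < a\<close> and
  the coefficients of \<open>\<partial>/\<partial>z\<^sub>1\<close> are those with \<open>i > 0\<close>, so nothing is left over when \<open>a > 0\<close>. Once \<open>a = 0\<close>, the
  conjugate derivatives do the same for \<open>b\<close>.
\<close>

lemma bipoly_eq_0D:
  assumes "\<And>z. bipoly a b c z = 0" "i \<le> a" "k \<le> b"
  shows "c i k = 0"
  using assms
proof (induction a arbitrary: c i)
  case 0
  from "0.prems" show ?case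
  proof (induction b arbitrary: c k)
    case 0
    then show ?case using "0.prems"(1)[of "(1, 1)"] by (simp add: bipoly_def)
  next
    case (Suc b)
    have "wirtinger_at (bipoly 0 (Suc b) c) 0 0 0 0 z" for z
      unfolding wirtinger_at_def using Suc.prems(1) by (simp add: bipoly_def[abs_def])
    from wirtinger_at_unique[OF this wirtinger_at_bipoly]
    have *: "bipoly 0 b (\<lambda>i k. of_bool (k < Suc b) * of_nat (Suc k) * c i (Suc k)) z = 0"
      "bipoly 0 b (\<lambda>i k. of_nat (Suc b - k) * c i k) z = 0" for z
      by (metis diff_Suc_1)+
    show ?case
    proof (cases "k \<le> b")
      case True
      then show ?thesis using Suc.IH[OF *(2) Suc.prems(2), of k] by (simp del: of_nat_diff)
    next
      case False
      then have k: "k = Suc b" using Suc.prems(3) by simp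
      show ?thesis using Suc.IH[OF *(1) Suc.prems(2), of b] by (simp add: k del: of_nat_Suc)
    qed
  qed
next
  case (Suc a)
  have "wirtinger_at (bipoly (Suc a) b c) 0 0 0 0 z" for z
    unfolding wirtinger_at_def using Suc.prems(1) by (simp add: bipoly_def[abs_def])
  from wirtinger_at_unique[OF this wirtinger_at_bipoly]
  have *: "bipoly a b (\<lambda>i k. of_bool (i < Suc a) * of_nat (Suc i) * c (Suc i) k) z = 0"
    "bipoly a b (\<lambda>i k. of_nat (Suc a - i) * c i k) z = 0" for z
    by (metis diff_Suc_1)+
  show ?case
  proof (cases "i \<le> a")
    case True
    then show ?thesis using Suc.IH[OF *(2) _ Suc.prems(3), of i] by (simp del: of_nat_diff)
  next
    case False
    then have i: "i = Suc a" using Suc.prems(2) by simp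
    show ?thesis using Suc.IH[OF *(1) _ Suc.prems(3), of a] by (simp add: i del: of_nat_Suc)
  qed
qed

lemma bipoly_eq_iff:
  "bipoly a b c = bipoly a b c' \<longleftrightarrow> (\<forall>i\<le>a. \<forall>k\<le>b. c i k = c' i k)"
proof
  assume eq: "bipoly a b c = bipoly a b c'"
  have "bipoly a b (\<lambda>i k. c i k - c' i k) z = bipoly a b c z - bipoly a b c' z" for z
    by (simp add: bipoly_def left_diff_distrib sum_subtractf)
  with eq have "bipoly a b (\<lambda>i k. c i k - c' i k) z = 0" for z by simp
  from bipoly_eq_0D[OF this] show "\<forall>i\<le>a. \<forall>k\<le>b. c i k = c' i k" by simp
qed (auto simp: bipoly_def fun_eq_iff)

section \<open>Witt relations and spinors\<close>

text \<open>
  Witt vectors and their adjoints are all combinations of \<open>e\<^sub>j\<close> and \<open>e\<^sub>2\<^sub>+\<^sub>j\<close>, so one bilinear identity yields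
  all their anticommutation relations.
\<close>

lemma witt_combination_anticommute:
  assumes "j \<in> {1, 2}" "k \<in> {1, 2}"
  shows "(p *\<^sub>c gen j + q *\<^sub>c gen (2 + j)) * (p' *\<^sub>c gen k + q' *\<^sub>c gen (2 + k)) +
      (p' *\<^sub>c gen k + q' *\<^sub>c gen (2 + k)) * (p *\<^sub>c gen j + q *\<^sub>c gen (2 + j)) =
      (if j = k then (- 2 * (p * p' + q * q')) *\<^sub>c 1 else 0)" (is "?L = _")
proof -
  have scale: "(x *\<^sub>c g) * (y *\<^sub>c h) + (y *\<^sub>c h) * (x *\<^sub>c g) = (x * y) *\<^sub>c (g * h + h * g)"
    for x y g h
    by (simp add: cliff_scale_mult cliff.scale_right_distrib mult.commute)
  have two: "x *\<^sub>c (- 2) = (- 2 * x) *\<^sub>c (1 :: cliff)" for x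
  proof -
    have *: "(- 2 :: cliff) = (- 2 :: complex) *\<^sub>c 1"
      using cliff.scale_left_distrib[of 1 1 1] by simp
    show ?thesis unfolding * cliff.scale_scale by (subst mult.commute) (rule refl)
  qed
  have "?L = (p * p') *\<^sub>c (gen j * gen k + gen k * gen j)
           + (p * q') *\<^sub>c (gen j * gen (2 + k) + gen (2 + k) * gen j)
           + (q * p') *\<^sub>c (gen (2 + j) * gen k + gen k * gen (2 + j))
           + (q * q') *\<^sub>c (gen (2 + j) * gen (2 + k) + gen (2 + k) * gen (2 + j))"
    unfolding scale[symmetric] by (simp add: algebra_simps)
  also have "\<dots> = (p * p') *\<^sub>c (if j = k then - 2 else 0) + (q * q') *\<^sub>c (if j = k then - 2 else 0)"
    using assms gen_anticommute[of j k] gen_anticommute[of j "2 + k"]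
      gen_anticommute[of "2 + j" k] gen_anticommute[of "2 + j" "2 + k"]
    by (elim insertE emptyE) simp_all
  also have "\<dots> = (if j = k then (- 2 * (p * p' + q * q')) *\<^sub>c 1 else 0)"
    by (cases "j = k")
      (simp_all only: two if_True if_False simp_thms cliff.scale_zero_right add_0_left distrib_left cliff.scale_left_distrib)
  finally show ?thesis .
qed

lemma witt_relations:
  assumes "j \<in> {1, 2}" "k \<in> {1, 2}"
  shows "witt j * witt k + witt k * witt j = 0"
    and "witt_dag j * witt_dag k + witt_dag k * witt_dag j = 0"
    and "witt j * witt_dag k + witt_dag k * witt j = (if j = k then 1 else 0)"
proof -
  have w: "witt j = (1/2) *\<^sub>c gen j + (- \<i>/2) *\<^sub>c gen (2 + j)"
    "witt_dag j = (- 1/2) *\<^sub>c gen j + (- \<i>/2) *\<^sub>c gen (2 + j)" for j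
    by (simp_all add: witt_def witt_dag_def cliff.scale_right_distrib cliff.scale_right_diff_distrib)
  show "witt j * witt k + witt k * witt j = 0"
    "witt_dag j * witt_dag k + witt_dag k * witt_dag j = 0"
    "witt j * witt_dag k + witt_dag k * witt j = (if j = k then 1 else 0)"
    unfolding w witt_combination_anticommute[OF assms] by simp_all
qed

text \<open>
  The relations oriented as rewrite rules: adjoints move to the left, and indices increase within each
  group. Together with the left-multiplied versions below they bring every word to its normal form.
\<close>

lemma witt_anticommute:
  "witt 1 * witt 1 = 0" "witt 2 * witt 2 = 0"
  "witt_dag 1 * witt_dag 1 = 0" "witt_dag 2 * witt_dag 2 = 0"
  "witt 2 * witt 1 = - (witt 1 * witt 2)"
  "witt_dag 2 * witt_dag 1 = - (witt_dag 1 * witt_dag 2)"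
  "witt 1 * witt_dag 1 = 1 - witt_dag 1 * witt 1"
  "witt 2 * witt_dag 2 = 1 - witt_dag 2 * witt 2"
  "witt 1 * witt_dag 2 = - (witt_dag 2 * witt 1)"
  "witt 2 * witt_dag 1 = - (witt_dag 1 * witt 2)"
proof -
  have half: "x = 0" if "x + x = 0" for x :: cliff
  proof -
    have "2 *\<^sub>c x = x + x" using cliff.scale_left_distrib[of 1 1 x] by simp
    with that show ?thesis by simp
  qed
  show "witt 1 * witt 1 = 0" "witt 2 * witt 2 = 0"
    "witt_dag 1 * witt_dag 1 = 0" "witt_dag 2 * witt_dag 2 = 0"
    by (rule half; rule witt_relations; simp)+
  show "witt 2 * witt 1 = - (witt 1 * witt 2)"
    "witt_dag 2 * witt_dag 1 = - (witt_dag 1 * witt_dag 2)"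
    using witt_relations(1,2)[of 1 2] by (simp_all add: eq_neg_iff_add_eq_0 add.commute)
  show "witt 1 * witt_dag 1 = 1 - witt_dag 1 * witt 1"
    "witt 2 * witt_dag 2 = 1 - witt_dag 2 * witt 2"
    using witt_relations(3)[of 1 1] witt_relations(3)[of 2 2] by (simp_all add: eq_diff_eq)
  show "witt 1 * witt_dag 2 = - (witt_dag 2 * witt 1)"
    "witt 2 * witt_dag 1 = - (witt_dag 1 * witt 2)"
    using witt_relations(3)[of 1 2] witt_relations(3)[of 2 1]
    by (simp_all add: eq_neg_iff_add_eq_0 add.commute)
qed

lemma witt_anticommute_left:
  "witt 1 * (witt 1 * x) = 0" "witt 2 * (witt 2 * x) = 0"
  "witt_dag 1 * (witt_dag 1 * x) = 0" "witt_dag 2 * (witt_dag 2 * x) = 0"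
  "witt 2 * (witt 1 * x) = - (witt 1 * (witt 2 * x))"
  "witt_dag 2 * (witt_dag 1 * x) = - (witt_dag 1 * (witt_dag 2 * x))"
  "witt 1 * (witt_dag 1 * x) = x - witt_dag 1 * (witt 1 * x)"
  "witt 2 * (witt_dag 2 * x) = x - witt_dag 2 * (witt 2 * x)"
  "witt 1 * (witt_dag 2 * x) = - (witt_dag 2 * (witt 1 * x))"
  "witt 2 * (witt_dag 1 * x) = - (witt_dag 1 * (witt 2 * x))"
  by (simp_all only: mult.assoc[symmetric] witt_anticommute)
    (simp_all add: left_diff_distrib)

lemmas normal_order = mult.assoc distrib_left left_diff_distrib right_diff_distrib
  witt_anticommute witt_anticommute_left

lemma witt_spinor_I: "witt 1 * spinor_I = 0" "witt 2 * spinor_I = 0"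
  by (simp_all add: spinor_I_def normal_order)

lemma witt_spinor:
  "witt 1 * f1I = spinor_I" "witt 1 * f2I = 0" "witt 2 * f1I = 0" "witt 2 * f2I = spinor_I"
  by (simp_all add: witt_anticommute_left witt_spinor_I)

lemma witt_dag_spinor:
  "witt_dag 1 * f1I = 0" "witt_dag 2 * f2I = 0" "witt_dag 2 * f1I = - (witt_dag 1 * f2I)"
  by (simp_all add: witt_anticommute_left)

text \<open>
  The two-sided ideal generated by \<open>I\<close> contains \<open>1\<close>: multiplying \<open>I\<close> by the first Witt pair and adding
  recovers the idempotent of the second pair, and in the same way that idempotent yields \<open>1\<close>.
\<close>

lemma spinor_I_nonzero: "spinor_I \<noteq> 0"
proof
  assume I: "spinor_I = 0"
  define e where "e = witt 2 * witt_dag 2"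
  have "e = witt 1 * (witt_dag 1 * spinor_I) + witt_dag 1 * spinor_I * witt 1"
    by (simp add: e_def spinor_I_def normal_order)
  then have "e = 0" by (simp add: I)
  then have "e + witt_dag 2 * e * witt 2 = 0" by simp
  moreover have "e + witt_dag 2 * e * witt 2 = 1"
    by (simp add: e_def normal_order)
  ultimately show False by simp
qed

lemma top_spinor_nonzero: "witt_dag 1 * f2I \<noteq> 0"
proof
  assume "witt_dag 1 * f2I = 0"
  moreover have "witt 2 * (witt 1 * (witt_dag 1 * f2I)) = spinor_I"
    by (simp add: witt_anticommute_left witt_spinor_I)
  ultimately show False using spinor_I_nonzero by simp
qed

lemma spinor_eq_iff:
  "x *\<^sub>c f1I + y *\<^sub>c f2I = x' *\<^sub>c f1I + y' *\<^sub>c f2I \<longleftrightarrow> x = x' \<and> y = y'"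
proof
  assume eq: "x *\<^sub>c f1I + y *\<^sub>c f2I = x' *\<^sub>c f1I + y' *\<^sub>c f2I"
  show "x = x' \<and> y = y'"
    using arg_cong[OF eq, of "\<lambda>g. witt 1 * g"] arg_cong[OF eq, of "\<lambda>g. witt 2 * g"] spinor_I_nonzero
    by (simp add: distrib_left cliff_scale_mult witt_spinor)
qed simp

text \<open>
  Left multiplication by a Witt vector maps its own spinor to \<open>I\<close> and the other one to \<open>0\<close>; reading off a
  nonzero coefficient of \<open>I\<close> afterwards gives linear coordinates that are defined on the whole algebra. They
  can be applied to the coefficients of a polynomial even before these are known to be spinors.
\<close>

lemma spinor_coordinates:
  obtains \<phi> \<psi> :: "cliff \<Rightarrow> complex" where
    "Vector_Spaces.linear cliff_scale (*) \<phi>" "\<phi> f1I = 1" "\<phi> f2I = 0"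
    "Vector_Spaces.linear cliff_scale (*) \<psi>" "\<psi> f1I = 0" "\<psi> f2I = 1"
proof -
  obtain A where A: "coef spinor_I A \<noteq> 0"
    using spinor_I_nonzero by (metis coef_inject ext zero_cliff.rep_eq)
  have lin: "Vector_Spaces.linear cliff_scale (*) (\<lambda>x. coef (u * x) A / coef spinor_I A)" for u
    by unfold_locales
      (simp_all add: distrib_left distrib_right plus_cliff.rep_eq cliff_scale.rep_eq cliff_scale_mult
        add_divide_distrib mult.assoc)
  show thesis
    by (rule that[OF lin[of "witt 1"] _ _ lin[of "witt 2"]])
      (use A in \<open>simp_all add: witt_spinor zero_cliff.rep_eq\<close>)
qed

section \<open>The monogenic equations on coefficients\<close>

definition spinor_poly ::
  "nat \<Rightarrow> nat \<Rightarrow> (nat \<Rightarrow> nat \<Rightarrow> complex) \<Rightarrow> (nat \<Rightarrow> nat \<Rightarrow> complex) \<Rightarrow> cfun" where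
  "spinor_poly a b \<alpha> \<beta> = (\<lambda>z. bipoly a b \<alpha> z *\<^sub>c f1I + bipoly a b \<beta> z *\<^sub>c f2I)"

lemma spinor_poly_eq_iff:
  "spinor_poly a b \<alpha> \<beta> = spinor_poly a b \<alpha>' \<beta>' \<longleftrightarrow>
     (\<forall>i\<le>a. \<forall>k\<le>b. \<alpha> i k = \<alpha>' i k \<and> \<beta> i k = \<beta>' i k)"
proof -
  have "spinor_poly a b \<alpha> \<beta> = spinor_poly a b \<alpha>' \<beta>' \<longleftrightarrow>
      bipoly a b \<alpha> = bipoly a b \<alpha>' \<and> bipoly a b \<beta> = bipoly a b \<beta>'"
    unfolding spinor_poly_def fun_eq_iff spinor_eq_iff by blast
  then show ?thesis by (auto simp: bipoly_eq_iff)
qed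

lemma bihomogeneous_spinor_poly: "bihomogeneous_poly a b (spinor_poly a b \<alpha> \<beta>)"
  unfolding bihomogeneous_poly_def
  by (rule exI[of _ "\<lambda>i k. \<alpha> i k *\<^sub>c f1I + \<beta> i k *\<^sub>c f2I"])
    (simp add: spinor_poly_def bipoly_def cliff.scale_sum_left sum.distrib
      cliff.scale_right_distrib mult.commute)

lemma spinor_space1_iff: "x \<in> spinor_space1 \<longleftrightarrow> (\<exists>p q. x = p *\<^sub>c f1I + q *\<^sub>c f2I)"
proof -
  have "x - p *\<^sub>c f1I - q *\<^sub>c f2I = 0 \<longleftrightarrow> x = p *\<^sub>c f1I + q *\<^sub>c f2I" for p q
    unfolding diff_diff_eq by simp
  then show ?thesis
    unfolding spinor_space1_def cliff.span_insert cliff.span_empty mem_Collect_eq singleton_iff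
    by blast
qed

lemma hmonogenic1_imp_spinor_poly:
  assumes "g \<in> hmonogenic1 a b"
  obtains \<alpha> \<beta> where "g = spinor_poly a b \<alpha> \<beta>"
proof -
  obtain \<phi> \<psi> :: "cliff \<Rightarrow> complex" where
    lin: "Vector_Spaces.linear cliff_scale (*) \<phi>" "Vector_Spaces.linear cliff_scale (*) \<psi>"
    and dual: "\<phi> f1I = 1" "\<phi> f2I = 0" "\<psi> f1I = 0" "\<psi> f2I = 1"
    by (rule spinor_coordinates)
  interpret \<phi>: Vector_Spaces.linear cliff_scale "(*)" \<phi> by fact
  interpret \<psi>: Vector_Spaces.linear cliff_scale "(*)" \<psi> by fact
  obtain c where c: "g (x, y) =
      (\<Sum>i\<le>a. \<Sum>k\<le>b. (x ^ i * y ^ (a - i) * cnj x ^ k * cnj y ^ (b - k)) *\<^sub>c c i k)" for x y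
    using assms by (auto simp: hmonogenic1_def bihomogeneous_poly_def)
  have "\<phi> (g z) = bipoly a b (\<lambda>i k. \<phi> (c i k)) z" "\<psi> (g z) = bipoly a b (\<lambda>i k. \<psi> (c i k)) z" for z
    by (cases z; simp add: c bipoly_def \<phi>.sum \<psi>.sum \<phi>.scale \<psi>.scale mult.commute)+
  moreover have "g z = \<phi> (g z) *\<^sub>c f1I + \<psi> (g z) *\<^sub>c f2I" for z
  proof -
    have "g z \<in> spinor_space1" using assms by (auto simp: hmonogenic1_def)
    then obtain p q where "g z = p *\<^sub>c f1I + q *\<^sub>c f2I" unfolding spinor_space1_iff by blast
    then show ?thesis by (simp add: \<phi>.add \<psi>.add \<phi>.scale \<psi>.scale dual)
  qed
  ultimately have "g = spinor_poly a b (\<lambda>i k. \<phi> (c i k)) (\<lambda>i k. \<psi> (c i k))"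
    unfolding spinor_poly_def by auto
  then show ?thesis by (rule that)
qed

text \<open>
  Applied to \<open>F f1I + G f2I\<close>, the first operator gives \<open>\<partial>G/\<partial>z\<^sub>1 - \<partial>F/\<partial>z\<^sub>2\<close> times the nonzero vector
  \<open>witt_dag 1 * f2I\<close>, and the adjoint one gives \<open>I\<close> times the sum of the derivatives of \<open>F\<close> by the first and
  of \<open>G\<close> by the second conjugate variable. Both scalar factors have to vanish, and uniqueness of the
  coefficients turns this into two recursions.
\<close>

lemma spinor_poly_hmonogenic1_iff:
  "spinor_poly a b \<alpha> \<beta> \<in> hmonogenic1 a b \<longleftrightarrow>
     (\<forall>i<a. \<forall>k\<le>b. of_nat (Suc i) * \<beta> (Suc i) k = of_nat (a - i) * \<alpha> i k) \<and>
     (\<forall>i\<le>a. \<forall>k<b. of_nat (Suc k) * \<alpha> i (Suc k) = - (of_nat (b - k) * \<beta> i k))"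
proof -
  note d = wirtinger_lift[OF wirtinger_at_bipoly wirtinger_at_bipoly]
  have dz: "dirac_z (spinor_poly a b \<alpha> \<beta>) z =
      (bipoly (a - 1) b (\<lambda>i k. of_bool (i < a) * of_nat (Suc i) * \<beta> (Suc i) k) z -
       bipoly (a - 1) b (\<lambda>i k. of_nat (a - i) * \<alpha> i k) z) *\<^sub>c (witt_dag 1 * f2I)" for z
    unfolding dirac_z_def spinor_poly_def d
    by (simp add: distrib_left cliff_scale_mult witt_dag_spinor cliff.scale_left_diff_distrib)
  have "dirac_z (spinor_poly a b \<alpha> \<beta>) = 0 \<longleftrightarrow>
      bipoly (a - 1) b (\<lambda>i k. of_bool (i < a) * of_nat (Suc i) * \<beta> (Suc i) k) =
      bipoly (a - 1) b (\<lambda>i k. of_nat (a - i) * \<alpha> i k)"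
    using top_spinor_nonzero unfolding fun_eq_iff dz by simp
  also have "\<dots> \<longleftrightarrow> (\<forall>i<a. \<forall>k\<le>b. of_nat (Suc i) * \<beta> (Suc i) k = of_nat (a - i) * \<alpha> i k)"
    unfolding bipoly_eq_iff
    by (cases a) (auto simp: less_Suc_eq_le simp del: of_nat_Suc of_nat_diff)
  finally have 1: "dirac_z (spinor_poly a b \<alpha> \<beta>) = 0 \<longleftrightarrow> \<dots>" .
  have dz_dag: "dirac_z_dag (spinor_poly a b \<alpha> \<beta>) z =
      (bipoly a (b - 1) (\<lambda>i k. of_bool (k < b) * of_nat (Suc k) * \<alpha> i (Suc k)) z +
       bipoly a (b - 1) (\<lambda>i k. of_nat (b - k) * \<beta> i k) z) *\<^sub>c spinor_I" for z
    unfolding dirac_z_dag_def spinor_poly_def d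
    by (simp add: distrib_left cliff_scale_mult witt_spinor cliff.scale_left_distrib)
  have "dirac_z_dag (spinor_poly a b \<alpha> \<beta>) = 0 \<longleftrightarrow>
      bipoly a (b - 1) (\<lambda>i k. of_bool (k < b) * of_nat (Suc k) * \<alpha> i (Suc k)) =
      bipoly a (b - 1) (\<lambda>i k. - (of_nat (b - k) * \<beta> i k))"
    using spinor_I_nonzero unfolding fun_eq_iff dz_dag
    by (simp add: add_eq_0_iff2) (simp add: bipoly_def sum_negf)
  also have "\<dots> \<longleftrightarrow> (\<forall>i\<le>a. \<forall>k<b. of_nat (Suc k) * \<alpha> i (Suc k) = - (of_nat (b - k) * \<beta> i k))"
    unfolding bipoly_eq_iff
    by (cases b) (auto simp: less_Suc_eq_le simp del: of_nat_Suc of_nat_diff)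
  finally have 2: "dirac_z_dag (spinor_poly a b \<alpha> \<beta>) = 0 \<longleftrightarrow> \<dots>" .
  have "range (spinor_poly a b \<alpha> \<beta>) \<subseteq> spinor_space1"
    unfolding spinor_poly_def using spinor_space1_iff by blast
  with 1 2 show ?thesis
    by (simp add: hmonogenic1_def bihomogeneous_spinor_poly)
qed

section \<open>Weight decomposition\<close>

text \<open>
  The solution of both recursions with \<open>\<alpha> = \<beta>\<close>, by the absorption identities for binomial coefficients.
\<close>

definition signed_binomials :: "nat \<Rightarrow> nat \<Rightarrow> nat \<Rightarrow> nat \<Rightarrow> complex" where
  "signed_binomials a b i k = (- 1) ^ k * of_nat (a choose i) * of_nat (b choose k)"

text \<open>
  Rotating \<open>z\<^sub>1\<close> multiplies the monomial with exponents \<open>i\<close>, \<open>k\<close> by the \<open>(i - k)\<close>-th power of the rotation.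
  The component of the series in weight \<open>m\<close> is scaled by \<open>L m\<close>; the shift by one on \<open>f2I\<close> is there because the
  recursions pair \<open>F\<close> in weight \<open>m\<close> with \<open>G\<close> in weight \<open>m + 1\<close>.
\<close>

definition weight_series :: "nat \<Rightarrow> nat \<Rightarrow> (int \<Rightarrow> complex) \<Rightarrow> cfun" where
  "weight_series a b L = spinor_poly a b
     (\<lambda>i k. L (int i - int k) * signed_binomials a b i k)
     (\<lambda>i k. L (int i - int k - 1) * signed_binomials a b i k)"

lemma signed_binomials_nonzero: "i \<le> a \<Longrightarrow> k \<le> b \<Longrightarrow> signed_binomials a b i k \<noteq> 0"
  by (simp add: signed_binomials_def)

lemma signed_binomials_Suc:
  "of_nat (Suc i) * signed_binomials a b (Suc i) k = of_nat (a - i) * signed_binomials a b i k"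
  "of_nat (Suc k) * signed_binomials a b i (Suc k) = - (of_nat (b - k) * signed_binomials a b i k)"
proof -
  have absorb: "of_nat (Suc j) * of_nat (n choose Suc j) = (of_nat (n - j) * of_nat (n choose j) :: complex)"
    for n j
    by (metis binomial_absorb_comp binomial_absorption of_nat_mult Suc_times_binomial_eq)
  have "of_nat (Suc i) * signed_binomials a b (Suc i) k =
      (- 1) ^ k * (of_nat (Suc i) * of_nat (a choose Suc i)) * of_nat (b choose k)"
    unfolding signed_binomials_def by (simp only: mult_ac)
  then show "of_nat (Suc i) * signed_binomials a b (Suc i) k = of_nat (a - i) * signed_binomials a b i k"
    unfolding absorb signed_binomials_def by (simp only: mult_ac)
  have "of_nat (Suc k) * signed_binomials a b i (Suc k) =
      - ((- 1) ^ k * of_nat (a choose i) * (of_nat (Suc k) * of_nat (b choose Suc k)))"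
    unfolding signed_binomials_def by (simp del: of_nat_Suc)
  then show "of_nat (Suc k) * signed_binomials a b i (Suc k) = - (of_nat (b - k) * signed_binomials a b i k)"
    unfolding absorb signed_binomials_def by (simp del: of_nat_diff)
qed

text \<open>
  Divided by the particular solution, the recursions say \<open>B\<^sub>i\<^sub>+\<^sub>1\<^sub>,\<^sub>k = A\<^sub>i\<^sub>,\<^sub>k\<close> and \<open>A\<^sub>i\<^sub>,\<^sub>k\<^sub>+\<^sub>1 = B\<^sub>i\<^sub>,\<^sub>k\<close>. They link all entries of
  one weight \<open>m\<close> into a single chain, which starts on the boundary \<open>k = 0\<close> with an \<open>A\<close> for \<open>m \<ge> 0\<close> and on
  \<open>i = 0\<close> with a \<open>B\<close> for \<open>m < 0\<close>. So each weight contributes one free parameter.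
\<close>

lemma hmonogenic1_eq_range_weight_series: "hmonogenic1 a b = range (weight_series a b)"
proof (intro equalityI subsetI)
  fix g assume g: "g \<in> hmonogenic1 a b"
  then obtain \<alpha> \<beta> where g_eq: "g = spinor_poly a b \<alpha> \<beta>" by (rule hmonogenic1_imp_spinor_poly)
  define w where "w = signed_binomials a b"
  define A where "A i k = \<alpha> i k / w i k" for i k
  define B where "B i k = \<beta> i k / w i k" for i k
  have \<alpha>: "\<alpha> i k = A i k * w i k" and \<beta>: "\<beta> i k = B i k * w i k" if "i \<le> a" "k \<le> b" for i k
    using signed_binomials_nonzero[OF that] by (simp_all add: A_def B_def w_def)
  from g have "\<forall>i<a. \<forall>k\<le>b. of_nat (Suc i) * \<beta> (Suc i) k = of_nat (a - i) * \<alpha> i k"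
    and "\<forall>i\<le>a. \<forall>k<b. of_nat (Suc k) * \<alpha> i (Suc k) = - (of_nat (b - k) * \<beta> i k)"
    unfolding g_eq spinor_poly_hmonogenic1_iff by blast+
  note rel = this
  have AB: "B (Suc i) k = A i k" if "i < a" "k \<le> b" for i k
  proof -
    have "of_nat (Suc i) * (B (Suc i) k * w (Suc i) k) = of_nat (a - i) * (A i k * w i k)"
      using rel(1) that \<alpha>[of i k] \<beta>[of "Suc i" k] by (metis Suc_leI less_imp_le)
    then have "B (Suc i) k * (of_nat (a - i) * w i k) = A i k * (of_nat (a - i) * w i k)"
      unfolding w_def signed_binomials_Suc(1)[symmetric]
      by (metis mult.left_commute signed_binomials_Suc(1))
    then show ?thesis
      using signed_binomials_nonzero[of i a k b] that
      by (simp add: w_def del: of_nat_diff)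
  qed
  have BA: "A i (Suc k) = B i k" if "i \<le> a" "k < b" for i k
  proof -
    have "of_nat (Suc k) * (A i (Suc k) * w i (Suc k)) = - (of_nat (b - k) * (B i k * w i k))"
      using rel(2) that \<alpha>[of i "Suc k"] \<beta>[of i k] by (metis Suc_leI less_imp_le)
    then have "A i (Suc k) * - (of_nat (b - k) * w i k) = B i k * - (of_nat (b - k) * w i k)"
      unfolding w_def
      by (metis mult.left_commute signed_binomials_Suc(2) mult_minus_right)
    then show ?thesis
      using signed_binomials_nonzero[of i a k b] that
      by (simp add: w_def del: of_nat_diff)
  qed
  \<comment> \<open>the first entry of the chain of weight \<open>m\<close>\<close>
  define L where "L m = (if m \<ge> 0 then A (nat m) 0 else B 0 (nat (- m - 1)))" for m
  have A: "A i k = L (int i - int k)" if "i \<le> a" "k \<le> b" for i k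
    using that
  proof (induction k arbitrary: i)
    case 0
    then show ?case by (simp add: L_def)
  next
    case (Suc k)
    show ?case
    proof (cases i)
      case 0
      then show ?thesis using BA[of 0 k] Suc.prems by (simp add: L_def)
    next
      case (Suc j)
      then show ?thesis using BA[of i k] AB[of j k] Suc.IH[of j] Suc.prems by simp
    qed
  qed
  have B: "B i k = L (int i - int k - 1)" if "i \<le> a" "k \<le> b" for i k
    using that AB[of "i - 1" k] A[of "i - 1" k]
    by (cases i) (simp_all add: L_def)
  have "g = weight_series a b L"
    unfolding g_eq weight_series_def spinor_poly_eq_iff
    using A B \<alpha> \<beta> by (simp add: w_def)
  then show "g \<in> range (weight_series a b)" by blast
next
  fix g assume "g \<in> range (weight_series a b)"
  then obtain L where "g = weight_series a b L" by blast
  moreover have "of_nat n * (L m * u) = L m * (of_nat n * u)" for n m and u :: complex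
    by (rule mult.left_commute)
  moreover have "int (Suc i) - int k - 1 = int i - int k" "int i - int (Suc k) = int i - int k - 1" for i k
    by simp_all
  ultimately show "g \<in> hmonogenic1 a b"
    unfolding weight_series_def
    by (simp only: spinor_poly_hmonogenic1_iff signed_binomials_Suc mult_minus_right) blast
qed

text \<open>
  Every weight from \<open>- b - 1\<close> to \<open>a\<close> occurs: the nonnegative ones at \<open>f1I\<close> with \<open>k = 0\<close>, the negative ones at
  \<open>f2I\<close> with \<open>i = 0\<close>.
\<close>

lemma weight_series_eq_iff:
  "weight_series a b L = weight_series a b L' \<longleftrightarrow> (\<forall>m\<in>{- int b - 1..int a}. L m = L' m)"
proof
  assume "weight_series a b L = weight_series a b L'"
  then have 1: "L (int i - int k) = L' (int i - int k)"
    and 2: "L (int i - int k - 1) = L' (int i - int k - 1)" if "i \<le> a" "k \<le> b" for i k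
    using that signed_binomials_nonzero[OF that]
    unfolding weight_series_def spinor_poly_eq_iff by auto
  show "\<forall>m\<in>{- int b - 1..int a}. L m = L' m"
  proof
    fix m assume m: "m \<in> {- int b - 1..int a}"
    show "L m = L' m"
      using 1[of "nat m" 0] 2[of 0 "nat (- m - 1)"] m by (cases "m \<ge> 0") (simp_all add: nat_le_iff)
  qed
next
  assume "\<forall>m\<in>{- int b - 1..int a}. L m = L' m"
  then show "weight_series a b L = weight_series a b L'"
    unfolding weight_series_def spinor_poly_eq_iff by auto
qed

lemma weight_series_add:
  "weight_series a b L + weight_series a b L' = weight_series a b (\<lambda>m. L m + L' m)"
  by (simp add: weight_series_def spinor_poly_def fun_eq_iff bipoly_def sum.distrib distrib_right
      cliff.scale_left_distrib)

lemma weight_series_scale: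
  "cfun_scale x (weight_series a b L) = weight_series a b (\<lambda>m. x * L m)"
  by (simp add: weight_series_def spinor_poly_def fun_eq_iff cfun_scale_def bipoly_def
      cliff.scale_right_distrib sum_distrib_left mult.assoc)

lemma weight_series_zero: "weight_series a b (\<lambda>m. 0) = 0"
  by (simp add: weight_series_def spinor_poly_def fun_eq_iff bipoly_def)

lemma weight_series_sum:
  "(\<Sum>x\<in>S. weight_series a b (L x)) = weight_series a b (\<lambda>m. \<Sum>x\<in>S. L x m)"
  by (induction S rule: infinite_finite_induct) (simp_all add: weight_series_zero weight_series_add)

lemma is_basis_weight_vectors:
  assumes ms: "distinct ms" "set ms = {- int b - 1..int a}"
    and \<gamma>: "\<And>m. m \<in> set ms \<Longrightarrow> \<gamma> m \<noteq> 0"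
  shows "is_basis (map (\<lambda>m. weight_series a b (\<lambda>n. if n = m then \<gamma> m else 0)) ms) (hmonogenic1 a b)"
proof -
  define v where "v m = weight_series a b (\<lambda>n. if n = m then \<gamma> m else 0)" for m
  define M where "M = {- int b - 1..int a}"
  have comb: "(\<Sum>m\<in>M. cfun_scale (u m) (v m)) = weight_series a b (\<lambda>m. u m * \<gamma> m)" for u
  proof -
    have "(\<Sum>m\<in>M. cfun_scale (u m) (v m)) =
        weight_series a b (\<lambda>n. \<Sum>m\<in>M. u m * (if n = m then \<gamma> m else 0))"
      by (simp add: v_def weight_series_scale weight_series_sum)
    also have "\<dots> = weight_series a b (\<lambda>m. u m * \<gamma> m)"
      unfolding weight_series_eq_iff by (auto simp: M_def if_distrib[of "\<lambda>x. _ * x"] cong: if_cong)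
    finally show ?thesis .
  qed
  have \<gamma>M: "\<gamma> m \<noteq> 0" if "m \<in> M" for m using \<gamma> that ms(2) by (simp add: M_def)
  have inj: "inj_on v M"
  proof (rule inj_onI)
    fix m n assume "m \<in> M" "n \<in> M" "v m = v n"
    then have "\<forall>l\<in>M. (if l = m then \<gamma> m else 0) = (if l = n then \<gamma> n else 0)"
      unfolding v_def weight_series_eq_iff M_def by blast
    from bspec[OF this \<open>m \<in> M\<close>] show "m = n"
      using \<gamma>M[OF \<open>m \<in> M\<close>] by (simp split: if_splits)
  qed
  have "\<not> cfun.dependent (v ` M)"
  proof (rule cfun.independent_if_scalars_zero)
    fix u g assume u: "(\<Sum>g\<in>v ` M. cfun_scale (u g) g) = 0" and "g \<in> v ` M"
    then obtain m where m: "m \<in> M" "g = v m" by blast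
    have "weight_series a b (\<lambda>m. u (v m) * \<gamma> m) = weight_series a b (\<lambda>m. 0)"
      using u by (simp add: sum.reindex[OF inj] comb[of "\<lambda>m. u (v m)"] weight_series_zero)
    then show "u g = 0"
      unfolding weight_series_eq_iff using m \<gamma>M[of m] by (auto simp: M_def)
  qed (simp add: M_def)
  moreover have "cfun.span (v ` M) = range (weight_series a b)"
  proof (rule equalityI)
    have "cfun.subspace (range (weight_series a b))"
      unfolding cfun.subspace_def
      by (auto simp: weight_series_add weight_series_scale simp flip: weight_series_zero[of a b])
    moreover have "v ` M \<subseteq> range (weight_series a b)" by (auto simp: v_def)
    ultimately show "cfun.span (v ` M) \<subseteq> range (weight_series a b)"
      by (intro cfun.span_minimal)
    show "range (weight_series a b) \<subseteq> cfun.span (v ` M)"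
    proof safe
      fix L
      have "weight_series a b L = weight_series a b (\<lambda>m. L m / \<gamma> m * \<gamma> m)"
        unfolding weight_series_eq_iff using \<gamma>M by (auto simp: M_def)
      also have "\<dots> = (\<Sum>m\<in>M. cfun_scale (L m / \<gamma> m) (v m))"
        by (rule comb[symmetric])
      also have "\<dots> \<in> cfun.span (v ` M)"
        by (intro cfun.span_sum cfun.span_scale cfun.span_base imageI)
      finally show "weight_series a b L \<in> cfun.span (v ` M)" .
    qed
  qed
  ultimately show ?thesis
    unfolding is_basis_def v_def[symmetric] hmonogenic1_eq_range_weight_series
    using ms inj by (simp add: distinct_map M_def)
qed

section \<open>Modified Jacobi polynomials as diagonal sums\<close>

definition diagonal :: "nat \<Rightarrow> nat \<Rightarrow> int \<Rightarrow> complex \<times> complex \<Rightarrow> complex" where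
  "diagonal a b m = bipoly a b (\<lambda>i k. of_bool (int i - int k = m) * signed_binomials a b i k)"

lemma weight_vector_eq:
  "weight_series a b (\<lambda>n. if n = m then \<gamma> else 0) =
     (\<lambda>z. (\<gamma> * diagonal a b m z) *\<^sub>c f1I + (\<gamma> * diagonal a b (m + 1) z) *\<^sub>c f2I)"
proof -
  have "bipoly a b (\<lambda>i k. (if int i - int k - l = m then \<gamma> else 0) * signed_binomials a b i k) z =
      \<gamma> * diagonal a b (m + l) z" for l z
    unfolding diagonal_def bipoly_def sum_distrib_left
    by (intro sum.cong refl) (auto simp: diff_eq_eq)
  from this[of 0] this[of 1] show ?thesis
    by (simp add: weight_series_def spinor_poly_def)
qed

lemma diagonal_eq_0: "int a < m \<Longrightarrow> diagonal a b m z = 0"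
  unfolding diagonal_def bipoly_def by (intro sum.neutral ballI) simp

lemma diagonal_eq_sum:
  assumes "m \<le> a" "l = min b (a - m)"
  shows "diagonal a b (int m) (x, y) = (\<Sum>r\<le>l.
    signed_binomials a b (m + r) r * (x ^ (m + r) * y ^ (a - (m + r)) * cnj x ^ r * cnj y ^ (b - r)))"
proof -
  define f where "f i k = signed_binomials a b i k * (x ^ i * y ^ (a - i) * cnj x ^ k * cnj y ^ (b - k))"
    for i k
  have "diagonal a b (int m) (x, y) = (\<Sum>i\<le>a. \<Sum>k\<le>b. of_bool (int i - int k = int m) * f i k)"
    by (simp add: diagonal_def bipoly_def f_def mult.assoc)
  also have "\<dots> = (\<Sum>k\<le>b. \<Sum>i\<le>a. if i = m + k then f i k else 0)"
    by (subst sum.swap) (intro sum.cong refl, auto)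
  also have "\<dots> = (\<Sum>k\<le>b. if m + k \<le> a then f (m + k) k else 0)"
    by simp
  also have "\<dots> = (\<Sum>k\<le>l. f (m + k) k)"
    using assms by (intro sum.mono_neutral_cong_right) auto
  finally show ?thesis by (simp add: f_def)
qed

text \<open>
  Conjugation exchanges the roles of \<open>a\<close> and \<open>b\<close> and negates the weight. By this symmetry the formulas for
  the \<open>q\<close> families follow from those for the \<open>p\<close> families.
\<close>

lemma diagonal_conj:
  assumes "0 \<le> m"
  shows "diagonal b a m (cnj x, cnj y) = (- 1) ^ nat m * diagonal a b (- m) (x, y)"
proof -
  have w: "of_bool (int k - int i = m) * signed_binomials b a k i =
      (- 1) ^ nat m * (of_bool (int i - int k = - m) * signed_binomials a b i k)" for i k
  proof (cases "int k - int i = m")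
    case True
    then have "k = nat m + i" using assms by auto
    with True show ?thesis by (simp add: signed_binomials_def power_add)
  next
    case False
    then have "int i - int k \<noteq> - m" by linarith
    with False show ?thesis by simp
  qed
  show ?thesis
    unfolding diagonal_def bipoly_def w
    by (subst sum.swap) (simp add: sum_distrib_left mult_ac)
qed

lemma jacobiQ_conj: "jacobiQ l \<alpha> \<beta> (cnj x, cnj y) = jacobiQ l \<alpha> \<beta> (x, y)"
  by (simp add: jacobiQ_def mult.commute)

text \<open>
  The first binomial coefficient is reflected so that, after multiplication by the power \<open>\<alpha>\<close> of \<open>z\<^sub>1\<close>, its lower
  index is the exponent of \<open>z\<^sub>1\<close>, just as in a diagonal sum.
\<close>

lemma jacobiQ_nat:
  "jacobiQ (int l) (int \<alpha>) (int \<beta>) (x, y) = (\<Sum>r\<le>l. (- 1) ^ r *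
     of_nat (l + \<alpha> choose (\<alpha> + r)) * of_nat (l + \<beta> choose r) *
     (x ^ r * cnj x ^ r * y ^ (l - r) * cnj y ^ (l - r)))"
proof -
  have "jacobiQ (int l) (int \<alpha>) (int \<beta>) (x, y) = (\<Sum>s\<le>l.
      of_nat (l + \<alpha> choose s) * of_nat (l + \<beta> choose (l - s)) * (- x * cnj x) ^ (l - s) * (y * cnj y) ^ s)"
    by (simp add: jacobiQ_def binomial_gbinomial)
  also have "\<dots> = (\<Sum>r\<le>l.
      of_nat (l + \<alpha> choose (l - r)) * of_nat (l + \<beta> choose r) * (- x * cnj x) ^ r * (y * cnj y) ^ (l - r))"
    by (rule sum.reindex_bij_witness[of _ "\<lambda>r. l - r" "\<lambda>s. l - s"]) auto
  also have "\<dots> = (\<Sum>r\<le>l. (- 1) ^ r *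
     of_nat (l + \<alpha> choose (\<alpha> + r)) * of_nat (l + \<beta> choose r) *
     (x ^ r * cnj x ^ r * y ^ (l - r) * cnj y ^ (l - r)))"
  proof (rule sum.cong[OF refl])
    fix r assume "r \<in> {..l}"
    then have "l + \<alpha> choose (l - r) = l + \<alpha> choose (\<alpha> + r)"
      by (subst binomial_symmetric) auto
    moreover have "(- x * cnj x) ^ r = (- 1) ^ r * (x ^ r * cnj x ^ r)"
      by (metis mult_minus1 mult_minus_left power_mult_distrib)
    ultimately show "of_nat (l + \<alpha> choose (l - r)) * of_nat (l + \<beta> choose r) * (- x * cnj x) ^ r *
        (y * cnj y) ^ (l - r) = (- 1) ^ r * of_nat (l + \<alpha> choose (\<alpha> + r)) * of_nat (l + \<beta> choose r) *
        (x ^ r * cnj x ^ r * y ^ (l - r) * cnj y ^ (l - r))"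
      by (simp add: power_mult_distrib)
  qed
  finally show ?thesis .
qed

text \<open>
  The diagonal of weight \<open>m\<close> leaves the rectangle of exponents through \<open>i = a\<close>. Then \<open>a\<close> and \<open>b\<close> are exactly the
  upper indices in \<open>Q\<close>, and the two sums agree term by term. For \<open>m > a\<close> the diagonal misses the rectangle, in
  accordance with the convention for negative index.
\<close>

lemma diagonal_eq_jacobiQ_short:
  assumes "0 \<le> m" "int a - int b \<le> m"
  shows "x powi m * cnj y powi (int b - int a + m) * jacobiQ (int a - m) m (int b - int a + m) (x, y) =
    diagonal a b m (x, y)"
proof (cases "m \<le> int a")
  case True
  define n where "n = nat m"
  define l where "l = a - n"
  have n: "m = int n" "n \<le> a" and l: "int a - m = int l" "int b - int a + m = int (b - l)" "l \<le> b" "a = n + l"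
    using assms True by (auto simp: n_def l_def)
  have "x powi m * cnj y powi (int b - int a + m) * jacobiQ (int a - m) m (int b - int a + m) (x, y) =
      x ^ n * cnj y ^ (b - l) * jacobiQ (int l) (int n) (int (b - l)) (x, y)"
    unfolding l(1,2) unfolding n(1) by (simp only: power_int_of_nat)
  also have "\<dots> = (\<Sum>r\<le>l. signed_binomials a b (n + r) r *
      (x ^ (n + r) * y ^ (a - (n + r)) * cnj x ^ r * cnj y ^ (b - r)))"
    unfolding jacobiQ_nat sum_distrib_left
  proof (rule sum.cong[OF refl])
    fix r assume "r \<in> {..l}"
    then have "b - r = (b - l) + (l - r)" "a - (n + r) = l - r" "l + n = a" "l + (b - l) = b"
      using l by auto
    then show "x ^ n * cnj y ^ (b - l) * ((- 1) ^ r * of_nat (l + n choose (n + r)) *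
        of_nat (l + (b - l) choose r) * (x ^ r * cnj x ^ r * y ^ (l - r) * cnj y ^ (l - r))) =
        signed_binomials a b (n + r) r * (x ^ (n + r) * y ^ (a - (n + r)) * cnj x ^ r * cnj y ^ (b - r))"
      by (simp only: signed_binomials_def power_add mult_ac)
  qed
  also have "\<dots> = diagonal a b m (x, y)"
    unfolding n(1) using n l by (intro diagonal_eq_sum[symmetric]) (auto simp: min_def)
  finally show ?thesis .
next
  case False
  then show ?thesis by (simp add: jacobiQ_def diagonal_eq_0)
qed

text \<open>
  The diagonal leaves the rectangle of exponents through \<open>k = b\<close> instead. The factorials that involve the
  summation variable in \<open>C(b + m, b - r) C(a - m, r)\<close> are those in \<open>C(a, m + r) C(b, r)\<close>, so the summands
  differ by a constant ratio of factorials, which explains the normalisation of the families with a tilde.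
\<close>

lemma diagonal_eq_jacobiQ_long:
  assumes "0 \<le> m" "m \<le> int a - int b"
  shows "x powi m * y powi (int a - m - int b) * jacobiQ (int b) m (int a - m - int b) (x, y) /
      (fact (nat (int a - m)) * fact (nat (int b + m))) = diagonal a b m (x, y) / (fact a * fact b)"
proof -
  define n where "n = nat m"
  define t where "t = a - n - b"
  have n: "m = int n" "n \<le> a" and t: "int a - m - int b = int t" "a = n + (b + t)"
    and nat: "nat (int a - m) = b + t" "nat (int b + m) = b + n"
    using assms by (auto simp: n_def t_def)
  have "x powi m * y powi (int a - m - int b) * jacobiQ (int b) m (int a - m - int b) (x, y) /
      (fact (nat (int a - m)) * fact (nat (int b + m))) =
      x ^ n * y ^ t * jacobiQ (int b) (int n) (int t) (x, y) / (fact (b + t) * fact (b + n))"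
    unfolding t(1) nat unfolding n(1) by (simp only: power_int_of_nat)
  also have "\<dots> = (\<Sum>r\<le>b. signed_binomials a b (n + r) r *
      (x ^ (n + r) * y ^ (a - (n + r)) * cnj x ^ r * cnj y ^ (b - r)) / (fact a * fact b))"
    unfolding jacobiQ_nat sum_distrib_left sum_divide_distrib
  proof (rule sum.cong[OF refl])
    fix r assume r: "r \<in> {..b}"
    have e: "a - (n + r) = t + (b - r)" and e2: "b + t - r = t + (b - r)" using r t(2) by auto
    have f1: "(of_nat (b + n choose (n + r)) :: complex) = fact (b + n) / (fact (n + r) * fact (b - r))"
      using r by (subst binomial_fact) auto
    have f2: "(of_nat (b + t choose r) :: complex) = fact (b + t) / (fact r * fact (t + (b - r)))"
      unfolding e2[symmetric] using r by (subst binomial_fact) auto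
    have f3: "(of_nat (a choose (n + r)) :: complex) = fact a / (fact (n + r) * fact (t + (b - r)))"
      unfolding e[symmetric] using r t(2) by (subst binomial_fact) auto
    have f4: "(of_nat (b choose r) :: complex) = fact b / (fact r * fact (b - r))"
      using r by (subst binomial_fact) auto
    show "x ^ n * y ^ t * ((- 1) ^ r * of_nat (b + n choose (n + r)) * of_nat (b + t choose r) *
        (x ^ r * cnj x ^ r * y ^ (b - r) * cnj y ^ (b - r))) / (fact (b + t) * fact (b + n)) =
        signed_binomials a b (n + r) r *
        (x ^ (n + r) * y ^ (a - (n + r)) * cnj x ^ r * cnj y ^ (b - r)) / (fact a * fact b)"
      unfolding signed_binomials_def e f1 f2 f3 f4
      by (simp add: power_add mult_ac)
  qed
  also have "\<dots> = diagonal a b m (x, y) / (fact a * fact b)"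
    unfolding n(1) using n t
    by (subst diagonal_eq_sum[where l = b]) (auto simp: min_def simp flip: sum_divide_distrib)
  finally show ?thesis .
qed

section \<open>The four families as weight vectors\<close>

lemma p_poly_eq:
  assumes "0 \<le> c" "int a - int b \<le> c"
  shows "p_poly a b c = weight_series a b (\<lambda>n. if n = c then 1 / (fact a * fact b) else 0)"
proof
  fix z :: "complex \<times> complex"
  obtain x y where z: "z = (x, y)" by (cases z)
  show "p_poly a b c z = weight_series a b (\<lambda>n. if n = c then 1 / (fact a * fact b) else 0) z"
    unfolding weight_vector_eq p_poly_def z
    using diagonal_eq_jacobiQ_short[of c a b x y] diagonal_eq_jacobiQ_short[of "c + 1" a b x y] assms
    by (simp add: cliff.scale_right_distrib diff_diff_eq add.assoc)
qed

text \<open>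
  The two components of a member of the \<open>q\<close> families, whose relative sign comes from the parities of \<open>d + 1\<close>
  and \<open>d\<close>.
\<close>

lemma diagonal_conj_pair:
  assumes "0 \<le> d"
  shows "diagonal b a (d + 1) (cnj x, cnj y) = (- 1) ^ nat (d + 1) * diagonal a b (- d - 1) (x, y)"
    and "diagonal b a d (cnj x, cnj y) = - ((- 1) ^ nat (d + 1) * diagonal a b (- d) (x, y))"
proof -
  have e: "- (d + 1) = - d - 1" by simp
  show "diagonal b a (d + 1) (cnj x, cnj y) = (- 1) ^ nat (d + 1) * diagonal a b (- d - 1) (x, y)"
    using diagonal_conj[of "d + 1" b a x y] assms unfolding e by simp
  show "diagonal b a d (cnj x, cnj y) = - ((- 1) ^ nat (d + 1) * diagonal a b (- d) (x, y))"
    using diagonal_conj[of d b a x y] assms by (simp add: nat_add_distrib)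
qed

lemma q_poly_eq:
  assumes "0 \<le> d" "int b - int a \<le> d"
  shows "q_poly a b d =
    weight_series a b (\<lambda>n. if n = - d - 1 then (- 1) ^ nat (d + 1) / (fact a * fact b) else 0)"
proof
  fix z :: "complex \<times> complex"
  obtain x y where z: "z = (x, y)" by (cases z)
  have e: "int a - int b + (d + 1) = int a - int b + d + 1" "int b - (d + 1) = int b - d - 1"
    "- d - 1 + 1 = - d" by simp_all
  have 1: "cnj x powi (d + 1) * y powi (int a - int b + d + 1) *
      jacobiQ (int b - d - 1) (d + 1) (int a - int b + d + 1) (x, y) =
      (- 1) ^ nat (d + 1) * diagonal a b (- d - 1) (x, y)"
    using diagonal_eq_jacobiQ_short[of "d + 1" b a "cnj x" "cnj y"] assms
    unfolding jacobiQ_conj diagonal_conj_pair[OF assms(1)] e by simp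
  have 2: "cnj x powi d * y powi (int a - int b + d) * jacobiQ (int b - d) d (int a - int b + d) (x, y) =
      - ((- 1) ^ nat (d + 1) * diagonal a b (- d) (x, y))"
    using diagonal_eq_jacobiQ_short[of d b a "cnj x" "cnj y"] assms
    unfolding jacobiQ_conj diagonal_conj_pair[OF assms(1)] by simp
  show "q_poly a b d z =
      weight_series a b (\<lambda>n. if n = - d - 1 then (- 1) ^ nat (d + 1) / (fact a * fact b) else 0) z"
    unfolding weight_vector_eq q_poly_def z prod.case 1 2 e
    by (simp add: cliff.scale_right_distrib)
qed

text \<open>
  The linear factors in the families with a tilde only lower one of the two factorials, which gives the
  constants that belong to the weights of the two components.
\<close>

lemma fact_cancel:
  fixes u v w :: complex
  shows "1 / (fact (Suc s) * fact (Suc t)) * (of_nat (Suc t) * u * v * w) = u * v * w / (fact (Suc s) * fact t)"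
    and "1 / (fact (Suc s) * fact (Suc t)) * (of_nat (Suc s) * u * v * w) = u * v * w / (fact s * fact (Suc t))"
  unfolding fact_Suc by (simp_all add: mult.assoc del: of_nat_Suc)

lemma p_tilde_eq:
  assumes "0 \<le> c" "c \<le> int a - int b - 1"
  shows "p_tilde a b c = weight_series a b (\<lambda>n. if n = c then 1 / (fact a * fact b) else 0)"
proof
  fix z :: "complex \<times> complex"
  obtain x y where z: "z = (x, y)" by (cases z)
  define s where "s = nat (int a - c - 1)"
  define t where "t = nat (int b + c)"
  have nat: "nat (int a - c) = Suc s" "nat (int b + c + 1) = Suc t" "nat (int b + c) = t"
    "nat (int a - (c + 1)) = s" "nat (int b + (c + 1)) = Suc t"
    and of_int: "(of_int (int a - c) :: complex) = of_nat (Suc s)"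
      "(of_int (int b + c + 1) :: complex) = of_nat (Suc t)"
    and e: "int a - c - int b - 1 = int a - (c + 1) - int b"
    using assms by (auto simp: s_def t_def)
  have 1: "x powi c * y powi (int a - c - int b) * jacobiQ (int b) c (int a - c - int b) (x, y) /
      (fact (Suc s) * fact t) = diagonal a b c (x, y) / (fact a * fact b)"
    using diagonal_eq_jacobiQ_long[of c a b x y] assms unfolding nat by simp
  have 2: "x powi (c + 1) * y powi (int a - (c + 1) - int b) *
      jacobiQ (int b) (c + 1) (int a - (c + 1) - int b) (x, y) /
      (fact s * fact (Suc t)) = diagonal a b (c + 1) (x, y) / (fact a * fact b)"
    using diagonal_eq_jacobiQ_long[of "c + 1" a b x y] assms unfolding nat by simp
  show "p_tilde a b c z = weight_series a b (\<lambda>n. if n = c then 1 / (fact a * fact b) else 0) z"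
    unfolding weight_vector_eq p_tilde_def z prod.case nat nat_int of_int e
      cliff.scale_right_distrib cliff.scale_scale fact_cancel 1 2
    by simp
qed

lemma q_tilde_eq:
  assumes "0 \<le> d" "d \<le> int b - int a - 1"
  shows "q_tilde a b d =
    weight_series a b (\<lambda>n. if n = - d - 1 then (- 1) ^ nat (d + 1) / (fact a * fact b) else 0)"
proof
  fix z :: "complex \<times> complex"
  obtain x y where z: "z = (x, y)" by (cases z)
  define s where "s = nat (int b - d - 1)"
  define t where "t = nat (int a + d)"
  have nat: "nat (int b - d) = Suc s" "nat (int a + d + 1) = Suc t" "nat (int a + d) = t"
    "nat (int b - (d + 1)) = s" "nat (int a + (d + 1)) = Suc t"
    and of_int: "(of_int (int b - d) :: complex) = of_nat (Suc s)"
      "(of_int (int a + d + 1) :: complex) = of_nat (Suc t)"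
    and e: "int b - d - int a - 1 = int b - (d + 1) - int a" "- d - 1 + 1 = - d"
    using assms by (auto simp: s_def t_def)
  have 1: "cnj x powi (d + 1) * cnj y powi (int b - (d + 1) - int a) *
      jacobiQ (int a) (d + 1) (int b - (d + 1) - int a) (x, y) /
      (fact s * fact (Suc t)) = (- 1) ^ nat (d + 1) * diagonal a b (- d - 1) (x, y) / (fact b * fact a)"
    using diagonal_eq_jacobiQ_long[of "d + 1" b a "cnj x" "cnj y"] assms
    unfolding jacobiQ_conj diagonal_conj_pair[OF assms(1)] nat by simp
  have 2: "cnj x powi d * cnj y powi (int b - d - int a) * jacobiQ (int a) d (int b - d - int a) (x, y) /
      (fact (Suc s) * fact t) = - ((- 1) ^ nat (d + 1) * diagonal a b (- d) (x, y)) / (fact b * fact a)"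
    using diagonal_eq_jacobiQ_long[of d b a "cnj x" "cnj y"] assms
    unfolding jacobiQ_conj diagonal_conj_pair[OF assms(1)] nat by simp
  show "q_tilde a b d z =
      weight_series a b (\<lambda>n. if n = - d - 1 then (- 1) ^ nat (d + 1) / (fact a * fact b) else 0) z"
    unfolding weight_vector_eq q_tilde_def z prod.case nat of_int e mult.commute[of "fact (Suc t)" "fact (Suc s)"]
      cliff.scale_right_diff_distrib cliff.scale_scale fact_cancel 1 2
    by (simp add: mult.commute)
qed

theorem corollary2:
  fixes a b :: nat
  shows "(a < b \<longrightarrow>
           is_basis (map (p_poly a b) [0..int a] @
                     map (q_tilde a b) [0..int b - int a - 1] @
                     map (q_poly a b) [int b - int a..int b])
             (hmonogenic1 a b)) \<and>
         (a > b \<longrightarrow>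
           is_basis (map (p_tilde a b) [0..int a - int b - 1] @
                     map (p_poly a b) [int a - int b..int a] @
                     map (q_poly a b) [0..int b])
             (hmonogenic1 a b)) \<and>
         (a = b \<longrightarrow>
           is_basis (map (p_poly a a) [0..int a] @ map (q_poly a a) [0..int a])
             (hmonogenic1 a a))"
proof -
  \<comment> \<open>one normalisation for all four families, with the sign \<open>(- 1) ^ (d + 1)\<close> in weight \<open>- d - 1\<close>\<close>
  define \<gamma> :: "int \<Rightarrow> complex" where
    "\<gamma> m = (if 0 \<le> m then 1 else (- 1) ^ nat (- m)) / (fact a * fact b)" for m
  define v where "v m = weight_series a b (\<lambda>n. if n = m then \<gamma> m else 0)" for m
  \<comment> \<open>the weight of the members of the \<open>q\<close> families with index \<open>d\<close>\<close>
  define \<sigma> :: "int \<Rightarrow> int" where "\<sigma> d = - d - 1" for d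
  have basis: "is_basis (map v ms) (hmonogenic1 a b)"
    if "distinct ms" "set ms = {- int b - 1..int a}" for ms
    unfolding v_def by (rule is_basis_weight_vectors) (use that in \<open>simp_all add: \<gamma>_def\<close>)
  have p: "p_poly a b c = v c" if "0 \<le> c" "int a - int b \<le> c" for c
    unfolding p_poly_eq[OF that] v_def using that by (simp add: \<gamma>_def cong: if_cong)
  have pt: "p_tilde a b c = v c" if "0 \<le> c" "c \<le> int a - int b - 1" for c
    unfolding p_tilde_eq[OF that] v_def using that by (simp add: \<gamma>_def cong: if_cong)
  have q: "q_poly a b d = v (\<sigma> d)" if "0 \<le> d" "int b - int a \<le> d" for d
    unfolding q_poly_eq[OF that] v_def using that by (simp add: \<gamma>_def \<sigma>_def add.commute cong: if_cong)
  have qt: "q_tilde a b d = v (\<sigma> d)" if "0 \<le> d" "d \<le> int b - int a - 1" for d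
    unfolding q_tilde_eq[OF that] v_def using that by (simp add: \<gamma>_def \<sigma>_def add.commute cong: if_cong)
  have img: "\<sigma> ` {i..j} = {- j - 1..- i - 1}" for i j
  proof -
    have "m \<in> \<sigma> ` {i..j}" if "m \<in> {- j - 1..- i - 1}" for m
      by (rule image_eqI[of _ _ "\<sigma> m"]) (use that in \<open>auto simp: \<sigma>_def\<close>)
    then show ?thesis by (auto simp: \<sigma>_def)
  qed
  have inj: "inj_on \<sigma> A" for A
    by (simp add: inj_on_def \<sigma>_def)
  have 1: "is_basis (map (p_poly a b) [0..int a] @
                     map (q_tilde a b) [0..int b - int a - 1] @
                     map (q_poly a b) [int b - int a..int b]) (hmonogenic1 a b)" if "a < b"
  proof -
    let ?ms = "[0..int a] @ map \<sigma> [0..int b - int a - 1] @ map \<sigma> [int b - int a..int b]"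
    have "is_basis (map v ?ms) (hmonogenic1 a b)"
      by (rule basis) (use that in \<open>auto simp: img distinct_map inj\<close>)
    also have "map v ?ms = map (p_poly a b) [0..int a] @
                     map (q_tilde a b) [0..int b - int a - 1] @
                     map (q_poly a b) [int b - int a..int b]"
      using that by (simp add: p q qt)
    finally show ?thesis .
  qed
  have 2: "is_basis (map (p_tilde a b) [0..int a - int b - 1] @
                     map (p_poly a b) [int a - int b..int a] @
                     map (q_poly a b) [0..int b]) (hmonogenic1 a b)" if "b \<le> a"
  proof -
    let ?ms = "[0..int a - int b - 1] @ [int a - int b..int a] @ map \<sigma> [0..int b]"
    have "is_basis (map v ?ms) (hmonogenic1 a b)"
      by (rule basis) (use that in \<open>auto simp: img distinct_map inj\<close>)
    also have "map v ?ms = map (p_tilde a b) [0..int a - int b - 1] @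
                     map (p_poly a b) [int a - int b..int a] @
                     map (q_poly a b) [0..int b]"
      using that by (simp add: p q pt)
    finally show ?thesis .
  qed
  \<comment> \<open>for \<open>a = b\<close> the tilde family of the previous case is empty\<close>
  have 3: "is_basis (map (p_poly a a) [0..int a] @ map (q_poly a a) [0..int a]) (hmonogenic1 a a)"
    if "a = b"
    using 2 that by simp
  from 1 2 3 show ?thesis by simp
qed

end
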